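(* Let $\mathbf A=(A,\oplus,\neg,0)$ be a semisimple MV-algebra with tense operators $G$ and $H$. Let $T$ be the set of all maximal proper filters of $\mathbf A$, and define the relation $\rho_G\subseteq T\times T$ by $$U\,\rho_G\, V\quad\text{if and only if}\quad G(x)/U\le x/V\ \text{ for all } x\in A.$$ Then $(\mathbf A,G,H)$ can be embedded into the tense MV-algebra $([0,1]^T,G^*,H^* )$ induced by the frame $(T,\rho_G)$; that is, there is an injective MV-morphism $e:\mathbf A\to[0,1]^T$ such that $e(G(x))=G^*(e(x))$ and $e(H(x))=H^*(e(x))$ for all $x\in A$.
   Context: An MV-algebra $(A,\oplus,\neg,0)$ has $1=\neg 0$, $x\odot y=\neg(\neg x\oplus\neg y)$, and order $x\le y$ iff $\neg x\oplus y=1$. The standard MV-algebra is $[0,1]$ with $a\oplus b=\min(1,a+b)$, $\neg a=1-a$. An MV-morphism is a map preserving $\oplus,\odot,\neg,0,1$. A filter of $\mathbf A$ is a subset containing $1$, upward closed, and closed under $\odot$; it is proper if it does not contain $0$. Filters correspond to congruences. $\mathbf A$ is semisimple if the intersection of its maximal proper filters is $\{1\}$. For a maximal proper filter $U$, the quotient $\mathbf A/U$ is simple and embeds uniquely in the standard MV-algebra $[0,1]$; the class $x/U$ is identified with its image in $[0,1]$. Unary operations $G,H$ on $A$ are tense operators (and $(\mathbf A,G,H)$ is a tense MV-algebra) if for all $x,y\in A$: (i) $G(1)=H(1)=1$; (ii) $G(x)\odot G(y)\le G(x\odot y)$, $H(x)\odot H(y)\le H(x\odot y)$; (iii) $G(x)\oplus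 G(y)\le G(x\oplus y)$, $H(x)\oplus H(y)\le H(x\oplus y)$; (iv) $G(x)\odot G(x)=G(x\odot x)$, $H(x)\odot H(x)=H(x\odot x)$; (v) $G(x)\oplus G(x)=G(x\oplus x)$, $H(x)\oplus H(x)=H(x\oplus x)$; (vi) $\neg G\neg H(x)\le x$, $\neg H\neg G(x)\le x$. For a set $T$ with a binary relation $\rho\subseteq T^2$, the tense MV-algebra $([0,1]^T,G^*,H^* )$ induced by the frame $(T,\rho)$ is the power MV-algebra $[0,1]^T$ (componentwise operations) with $G^*(x)(i)=\bigwedge_{i\rho j}x(j)$ and $H^*(x)(i)=\bigwedge_{j\rho i}x(j)$, where the infimum of the empty set is $1$. *)

theory Defs
  imports Complex_Main "HOL-Algebra.Congruence"
begin

record 'a mv_struct = "'a partial_object" +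
  mv_plus :: "'a \<Rightarrow> 'a \<Rightarrow> 'a"  (infixl \<open>\<oplus>\<index>\<close> 65)
  mv_neg :: "'a \<Rightarrow> 'a"  (\<open>\<sim>\<index> _\<close> [81] 80)
  mv_zero :: 'a  (\<open>\<zero>\<index>\<close>)

definition mv_one :: "('a, 'm) mv_struct_scheme \<Rightarrow> 'a"  (\<open>\<one>\<index>\<close>)
  where "\<one>\<^bsub>A\<^esub> = \<sim>\<^bsub>A\<^esub> \<zero>\<^bsub>A\<^esub>"

definition mv_times :: "('a, 'm) mv_struct_scheme \<Rightarrow> 'a \<Rightarrow> 'a \<Rightarrow> 'a"  (infixl \<open>\<odot>\<index>\<close> 70)
  where "x \<odot>\<^bsub>A\<^esub> y = \<sim>\<^bsub>A\<^esub> (\<sim>\<^bsub>A\<^esub> x \<oplus>\<^bsub>A\<^esub> \<sim>\<^bsub>A\<^esub> y)"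

definition mv_le :: "('a, 'm) mv_struct_scheme \<Rightarrow> 'a \<Rightarrow> 'a \<Rightarrow> bool"  (infix \<open>\<preceq>\<index>\<close> 50)
  where "x \<preceq>\<^bsub>A\<^esub> y \<longleftrightarrow> \<sim>\<^bsub>A\<^esub> x \<oplus>\<^bsub>A\<^esub> y = \<one>\<^bsub>A\<^esub>"

locale mv_algebra =
  fixes A (structure)
  assumes plus_closed [intro, simp]:
      "\<lbrakk>x \<in> carrier A; y \<in> carrier A\<rbrakk> \<Longrightarrow> x \<oplus> y \<in> carrier A"
    and neg_closed [intro, simp]: "x \<in> carrier A \<Longrightarrow> \<sim> x \<in> carrier A"
    and zero_closed [intro, simp]: "\<zero> \<in> carrier A"
    and plus_assoc: "\<lbrakk>x \<in> carrier A; y \<in> carrier A; z \<in> carrier A\<rbrakk>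
      \<Longrightarrow> (x \<oplus> y) \<oplus> z = x \<oplus> (y \<oplus> z)"
    and plus_comm: "\<lbrakk>x \<in> carrier A; y \<in> carrier A\<rbrakk> \<Longrightarrow> x \<oplus> y = y \<oplus> x"
    and plus_zero [simp]: "x \<in> carrier A \<Longrightarrow> x \<oplus> \<zero> = x"
    and neg_neg [simp]: "x \<in> carrier A \<Longrightarrow> \<sim> (\<sim> x) = x"
    and plus_one [simp]: "x \<in> carrier A \<Longrightarrow> x \<oplus> \<one> = \<one>"
    and lukasiewicz: "\<lbrakk>x \<in> carrier A; y \<in> carrier A\<rbrakk>
      \<Longrightarrow> \<sim> (\<sim> x \<oplus> y) \<oplus> y = \<sim> (\<sim> y \<oplus> x) \<oplus> x"

definition mv_hom ::
    "('a, 'm) mv_struct_scheme \<Rightarrow> ('b, 'n) mv_struct_scheme \<Rightarrow> ('a \<Rightarrow> 'b) set"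
  where "mv_hom A B = {h. h \<in> carrier A \<rightarrow> carrier B
    \<and> (\<forall>x\<in>carrier A. \<forall>y\<in>carrier A. h (x \<oplus>\<^bsub>A\<^esub> y) = h x \<oplus>\<^bsub>B\<^esub> h y)
    \<and> (\<forall>x\<in>carrier A. \<forall>y\<in>carrier A. h (x \<odot>\<^bsub>A\<^esub> y) = h x \<odot>\<^bsub>B\<^esub> h y)
    \<and> (\<forall>x\<in>carrier A. h (\<sim>\<^bsub>A\<^esub> x) = \<sim>\<^bsub>B\<^esub> h x)
    \<and> h \<zero>\<^bsub>A\<^esub> = \<zero>\<^bsub>B\<^esub> \<and> h \<one>\<^bsub>A\<^esub> = \<one>\<^bsub>B\<^esub>}"

definition mv_filter :: "('a, 'm) mv_struct_scheme \<Rightarrow> 'a set \<Rightarrow> bool"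
  where "mv_filter A F \<longleftrightarrow> F \<subseteq> carrier A \<and> \<one>\<^bsub>A\<^esub> \<in> F
    \<and> (\<forall>x\<in>F. \<forall>y\<in>carrier A. x \<preceq>\<^bsub>A\<^esub> y \<longrightarrow> y \<in> F)
    \<and> (\<forall>x\<in>F. \<forall>y\<in>F. x \<odot>\<^bsub>A\<^esub> y \<in> F)"

definition proper_mv_filter :: "('a, 'm) mv_struct_scheme \<Rightarrow> 'a set \<Rightarrow> bool"
  where "proper_mv_filter A F \<longleftrightarrow> mv_filter A F \<and> \<zero>\<^bsub>A\<^esub> \<notin> F"

definition max_filters :: "('a, 'm) mv_struct_scheme \<Rightarrow> 'a set set"
  where "max_filters A =
    {U. proper_mv_filter A U \<and> (\<forall>F. proper_mv_filter A F \<and> U \<subseteq> F \<longrightarrow> F = U)}"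

text \<open>Intersecting with the carrier makes the one-element algebra, which has no proper filter,
  semisimple.\<close>

definition semisimple_mv :: "('a, 'm) mv_struct_scheme \<Rightarrow> bool"
  where "semisimple_mv A \<longleftrightarrow> carrier A \<inter> \<Inter> (max_filters A) = {\<one>\<^bsub>A\<^esub>}"

text \<open>The congruence of a filter \<open>F\<close> identifies \<open>x\<close> and \<open>y\<close> iff both implications
  \<open>x \<rightarrow> y = \<sim> x \<oplus> y\<close> and \<open>y \<rightarrow> x\<close> belong to \<open>F\<close>. The quotient operations are written as unions
  over all representatives; since the relation is a congruence, all the sets united coincide.\<close>

definition filter_cong :: "('a, 'm) mv_struct_scheme \<Rightarrow> 'a set \<Rightarrow> ('a \<times> 'a) set"
  where "filter_cong A F = {(x, y). x \<in> carrier A \<and> y \<in> carrier A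
    \<and> \<sim>\<^bsub>A\<^esub> x \<oplus>\<^bsub>A\<^esub> y \<in> F \<and> \<sim>\<^bsub>A\<^esub> y \<oplus>\<^bsub>A\<^esub> x \<in> F}"

definition mv_quotient :: "('a, 'm) mv_struct_scheme \<Rightarrow> 'a set \<Rightarrow> 'a set mv_struct"
  where "mv_quotient A F =
    \<lparr>carrier = carrier A // filter_cong A F,
     mv_plus = (\<lambda>X Y. \<Union>x\<in>X. \<Union>y\<in>Y. filter_cong A F `` {x \<oplus>\<^bsub>A\<^esub> y}),
     mv_neg = (\<lambda>X. \<Union>x\<in>X. filter_cong A F `` {\<sim>\<^bsub>A\<^esub> x}),
     mv_zero = filter_cong A F `` {\<zero>\<^bsub>A\<^esub>}\<rparr>"

definition std_mv :: "real mv_struct"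
  where "std_mv = \<lparr>carrier = {0..1}, mv_plus = (\<lambda>a b. min 1 (a + b)),
    mv_neg = (\<lambda>a. 1 - a), mv_zero = 0\<rparr>"

text \<open>For a maximal proper filter \<open>U\<close> there is exactly one embedding of the quotient by \<open>U\<close> into
  the standard algebra. Requiring the function to be extensional makes it unique also as a HOL
  function, whose values outside the carrier would otherwise be arbitrary.\<close>

definition quotient_emb :: "('a, 'm) mv_struct_scheme \<Rightarrow> 'a set \<Rightarrow> 'a set \<Rightarrow> real"
  where "quotient_emb A U = (THE h. h \<in> mv_hom (mv_quotient A U) std_mv
    \<and> inj_on h (carrier (mv_quotient A U)) \<and> h \<in> extensional (carrier (mv_quotient A U)))"

text \<open>The real number written \<open>x / U\<close>.\<close>

definition quotient_val :: "('a, 'm) mv_struct_scheme \<Rightarrow> 'a set \<Rightarrow> 'a \<Rightarrow> real"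
  where "quotient_val A U x = quotient_emb A U (filter_cong A U `` {x})"

locale tense_mv_algebra = mv_algebra A for A (structure) +
  fixes G H :: "'a \<Rightarrow> 'a"
  assumes G_closed [intro, simp]: "x \<in> carrier A \<Longrightarrow> G x \<in> carrier A"
    and H_closed [intro, simp]: "x \<in> carrier A \<Longrightarrow> H x \<in> carrier A"
    and G_one: "G \<one> = \<one>"
    and H_one: "H \<one> = \<one>"
    and G_times: "\<lbrakk>x \<in> carrier A; y \<in> carrier A\<rbrakk> \<Longrightarrow> G x \<odot> G y \<preceq> G (x \<odot> y)"
    and H_times: "\<lbrakk>x \<in> carrier A; y \<in> carrier A\<rbrakk> \<Longrightarrow> H x \<odot> H y \<preceq> H (x \<odot> y)"
    and G_plus: "\<lbrakk>x \<in> carrier A; y \<in> carrier A\<rbrakk> \<Longrightarrow> G x \<oplus> G y \<preceq> G (x \<oplus> y)"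
    and H_plus: "\<lbrakk>x \<in> carrier A; y \<in> carrier A\<rbrakk> \<Longrightarrow> H x \<oplus> H y \<preceq> H (x \<oplus> y)"
    and G_square: "x \<in> carrier A \<Longrightarrow> G x \<odot> G x = G (x \<odot> x)"
    and H_square: "x \<in> carrier A \<Longrightarrow> H x \<odot> H x = H (x \<odot> x)"
    and G_double: "x \<in> carrier A \<Longrightarrow> G x \<oplus> G x = G (x \<oplus> x)"
    and H_double: "x \<in> carrier A \<Longrightarrow> H x \<oplus> H x = H (x \<oplus> x)"
    and G_H: "x \<in> carrier A \<Longrightarrow> \<sim> (G (\<sim> (H x))) \<preceq> x"
    and H_G: "x \<in> carrier A \<Longrightarrow> \<sim> (H (\<sim> (G x))) \<preceq> x"

text \<open>The power of the standard algebra by an index set \<open>T\<close> consists of the extensional functions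
  on \<open>T\<close>, so that equality of elements is equality of functions.\<close>

definition power_mv :: "'t set \<Rightarrow> ('t \<Rightarrow> real) mv_struct"
  where "power_mv T = \<lparr>carrier = T \<rightarrow>\<^sub>E carrier std_mv,
    mv_plus = (\<lambda>f g. \<lambda>i\<in>T. f i \<oplus>\<^bsub>std_mv\<^esub> g i),
    mv_neg = (\<lambda>f. \<lambda>i\<in>T. \<sim>\<^bsub>std_mv\<^esub> f i),
    mv_zero = (\<lambda>i\<in>T. \<zero>\<^bsub>std_mv\<^esub>)\<rparr>"

text \<open>Infimum in the lattice \<open>[0,1]\<close>; the value of \<open>Inf {}\<close> on the reals is not \<open>1\<close>.\<close>

definition unit_Inf :: "real set \<Rightarrow> real"
  where "unit_Inf S = (if S = {} then 1 else Inf S)"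

definition frame_G :: "'t set \<Rightarrow> ('t \<times> 't) set \<Rightarrow> ('t \<Rightarrow> real) \<Rightarrow> ('t \<Rightarrow> real)"
  where "frame_G T \<rho> f = (\<lambda>i\<in>T. unit_Inf (f ` {j \<in> T. (i, j) \<in> \<rho>}))"

definition frame_H :: "'t set \<Rightarrow> ('t \<times> 't) set \<Rightarrow> ('t \<Rightarrow> real) \<Rightarrow> ('t \<Rightarrow> real)"
  where "frame_H T \<rho> f = (\<lambda>i\<in>T. unit_Inf (f ` {j \<in> T. (j, i) \<in> \<rho>}))"

definition tense_rel ::
    "('a, 'm) mv_struct_scheme \<Rightarrow> ('a \<Rightarrow> 'a) \<Rightarrow> ('a set \<times> 'a set) set"
  where "tense_rel A G = {(U, V). U \<in> max_filters A \<and> V \<in> max_filters A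
    \<and> (\<forall>x\<in>carrier A. quotient_val A U (G x) \<le> quotient_val A V x)}"

end

theory Submission
  imports Defs
begin

text \<open>Each maximal filter \<open>U\<close> gives a morphism \<open>x \<mapsto> x / U\<close> into \<open>[0, 1]\<close> whose value at \<open>x\<close> is \<open>1\<close> exactly
  when \<open>x \<in> U\<close>, and the embedding sends \<open>x\<close> to the family of all its values. Semisimplicity makes
  it injective. That \<open>x / U\<close> is well defined and that the operators become infima are the two
  things to prove.

  The values exist because the quotient by a maximal filter is totally ordered (lemma
  \<open>quotient_mv_chain\<close>), and every nontrivial MV-chain maps to \<open>[0, 1]\<close> by reading off binary digits:
  the first digit of \<open>x\<close> says whether \<open>\<sim> x \<preceq> x\<close>, and the remaining ones are the digits of \<open>x \<odot> x\<close>
  or \<open>x \<oplus> x\<close>. The error of additivity at a pair of summands is zero or half the error at another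
  pair, so it vanishes (lemmas \<open>binary_plus_summable\<close> and \<open>binary_hom\<close>). No ordered group has to be built.

  All the remaining comparisons of real-valued functions rest on the observation that words in the
  two operations \<open>x \<oplus> x\<close> and \<open>x \<odot> x\<close> separate reals: for \<open>a < b\<close> in \<open>[0, 1]\<close> some word sends \<open>a\<close> to
  \<open>0\<close> and \<open>b\<close> to \<open>1\<close> (lemma \<open>separating_word\<close>). Functions into \<open>[0, 1]\<close> that commute with these two
  operations are therefore compared by looking only at where they are \<open>1\<close> (lemma
  \<open>doubling_map_le\<close>). In particular the embedding of the quotient is unique.

  Now fix \<open>U\<close> and put \<open>s x = G x / U\<close>. If \<open>s x < r\<close>, a word \<open>c\<close> in \<open>x\<close> has \<open>s c = 0\<close> although the same
  word sends \<open>r\<close> to \<open>1\<close>. Doubling preserves the value \<open>0\<close>, so \<open>s\<close> vanishes at every multiple of \<open>c\<close>,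
  and hence the filter \<open>{y. s y = 1}\<close> can be enlarged to a maximal filter \<open>V\<close> containing \<open>\<sim> c\<close>. Then
  \<open>s \<le> (_ / V)\<close> by the comparison principle, and \<open>x / V < r\<close> because \<open>c / V = 0\<close>. So \<open>s x\<close> is the
  infimum of the values \<open>x / V\<close> over all \<open>V\<close> related to \<open>U\<close> (lemma \<open>semistate_eq_Inf\<close>). The same
  applies to \<open>H\<close>, whose relation is the converse of that of \<open>G\<close> by the adjunction axioms (lemma
  \<open>tense_rel_converse\<close>).\<close>

section \<open>Arithmetic in MV-algebras\<close>

context mv_algebra
begin

lemma one_closed [intro, simp]: "\<one> \<in> carrier A"
  by (simp add: mv_one_def)

lemma times_closed [intro, simp]: "\<lbrakk>x \<in> carrier A; y \<in> carrier A\<rbrakk> \<Longrightarrow> x \<odot> y \<in> carrier A"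
  by (simp add: mv_times_def)

lemma plus_left_comm:
  "\<lbrakk>x \<in> carrier A; y \<in> carrier A; z \<in> carrier A\<rbrakk> \<Longrightarrow> x \<oplus> (y \<oplus> z) = y \<oplus> (x \<oplus> z)"
  by (metis plus_assoc plus_comm)

lemmas plus_ac = plus_assoc plus_comm plus_left_comm

lemma neg_zero [simp]: "\<sim> \<zero> = \<one>"
  by (rule mv_one_def [symmetric])

lemma neg_one [simp]: "\<sim> \<one> = \<zero>"
  by (metis neg_neg neg_zero zero_closed)

lemma zero_plus [simp]: "x \<in> carrier A \<Longrightarrow> \<zero> \<oplus> x = x"
  by (metis plus_comm plus_zero zero_closed)

lemma one_plus [simp]: "x \<in> carrier A \<Longrightarrow> \<one> \<oplus> x = \<one>"
  by (metis plus_comm plus_one one_closed)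

lemma neg_plus_self [simp]: "x \<in> carrier A \<Longrightarrow> \<sim> x \<oplus> x = \<one>"
  using lukasiewicz[of x "\<one>"] by simp

lemma plus_neg_self [simp]: "x \<in> carrier A \<Longrightarrow> x \<oplus> \<sim> x = \<one>"
  by (metis neg_plus_self neg_closed plus_comm)

lemma neg_inject: "\<lbrakk>x \<in> carrier A; y \<in> carrier A; \<sim> x = \<sim> y\<rbrakk> \<Longrightarrow> x = y"
  by (metis neg_neg)

lemma times_comm: "\<lbrakk>x \<in> carrier A; y \<in> carrier A\<rbrakk> \<Longrightarrow> x \<odot> y = y \<odot> x"
  by (simp add: mv_times_def plus_comm)

lemma neg_times: "\<lbrakk>x \<in> carrier A; y \<in> carrier A\<rbrakk> \<Longrightarrow> \<sim> (x \<odot> y) = \<sim> x \<oplus> \<sim> y"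
  by (simp add: mv_times_def)

lemma neg_plus: "\<lbrakk>x \<in> carrier A; y \<in> carrier A\<rbrakk> \<Longrightarrow> \<sim> (x \<oplus> y) = \<sim> x \<odot> \<sim> y"
  by (simp add: mv_times_def)

lemma le_refl [simp]: "x \<in> carrier A \<Longrightarrow> x \<preceq> x"
  by (simp add: mv_le_def)

lemma le_one [simp]: "x \<in> carrier A \<Longrightarrow> x \<preceq> \<one>"
  by (simp add: mv_le_def)

lemma zero_le [simp]: "x \<in> carrier A \<Longrightarrow> \<zero> \<preceq> x"
  by (simp add: mv_le_def)

lemma le_antisym: "\<lbrakk>x \<in> carrier A; y \<in> carrier A; x \<preceq> y; y \<preceq> x\<rbrakk> \<Longrightarrow> x = y"
  using lukasiewicz[of x y] by (simp add: mv_le_def)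

lemma le_plus: "\<lbrakk>x \<in> carrier A; y \<in> carrier A\<rbrakk> \<Longrightarrow> x \<preceq> x \<oplus> y"
  unfolding mv_le_def using plus_assoc[of "\<sim> x" x y] by simp

lemma le_plus_left: "\<lbrakk>x \<in> carrier A; y \<in> carrier A\<rbrakk> \<Longrightarrow> x \<preceq> y \<oplus> x"
  by (metis le_plus plus_comm)

text \<open>Together with \<open>le_plus\<close> this says that the order is divisibility for \<open>\<oplus>\<close>, which reduces
  transitivity and monotonicity to associativity.\<close>

lemma le_eq_plus_diff:
  assumes "x \<in> carrier A" "y \<in> carrier A" "x \<preceq> y"
  shows "y = x \<oplus> (y \<odot> \<sim> x)"
  using assms lukasiewicz[of y x]
  by (simp add: mv_le_def mv_times_def) (metis neg_closed plus_closed plus_comm)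

lemma le_trans:
  assumes "x \<in> carrier A" "y \<in> carrier A" "z \<in> carrier A" "x \<preceq> y" "y \<preceq> z"
  shows "x \<preceq> z"
proof -
  have "z = x \<oplus> ((y \<odot> \<sim> x) \<oplus> (z \<odot> \<sim> y))"
    using le_eq_plus_diff[of x y] le_eq_plus_diff[of y z] assms
    by (metis neg_closed plus_assoc times_closed)
  then show ?thesis
    using assms by (metis le_plus neg_closed plus_closed times_closed)
qed

lemma plus_mono_left:
  assumes "x \<in> carrier A" "y \<in> carrier A" "z \<in> carrier A" "x \<preceq> y"
  shows "x \<oplus> z \<preceq> y \<oplus> z"
proof -
  have "y \<oplus> z = (x \<oplus> z) \<oplus> (y \<odot> \<sim> x)"
    using le_eq_plus_diff[of x y] assms
    by (metis neg_closed plus_assoc plus_comm times_closed)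
  then show ?thesis
    using assms by (metis le_plus neg_closed plus_closed times_closed)
qed

lemma plus_mono:
  assumes "x \<in> carrier A" "y \<in> carrier A" "z \<in> carrier A" "w \<in> carrier A" "x \<preceq> y" "z \<preceq> w"
  shows "x \<oplus> z \<preceq> y \<oplus> w"
  using plus_mono_left[of x y z] plus_mono_left[of z w y] assms
    le_trans[of "x \<oplus> z" "y \<oplus> z" "y \<oplus> w"] by (simp add: plus_comm)

lemma neg_le_neg_iff [simp]:
  "\<lbrakk>x \<in> carrier A; y \<in> carrier A\<rbrakk> \<Longrightarrow> \<sim> x \<preceq> \<sim> y \<longleftrightarrow> y \<preceq> x"
  by (simp add: mv_le_def plus_comm)

lemma le_neg_comm: "\<lbrakk>x \<in> carrier A; y \<in> carrier A; x \<preceq> \<sim> y\<rbrakk> \<Longrightarrow> y \<preceq> \<sim> x"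
  by (simp add: mv_le_def plus_comm)

lemma residuation:
  "\<lbrakk>x \<in> carrier A; y \<in> carrier A; z \<in> carrier A\<rbrakk> \<Longrightarrow> x \<odot> y \<preceq> z \<longleftrightarrow> x \<preceq> \<sim> y \<oplus> z"
  by (simp add: mv_le_def mv_times_def plus_assoc)

lemma le_sup: 
  assumes "x \<in> carrier A" "y \<in> carrier A"
  shows "x \<preceq> y \<oplus> (x \<odot> \<sim> y)"
  using assms residuation[of x "\<sim> y" "x \<odot> \<sim> y"] by simp

lemma plus_times_le:
  assumes "p \<in> carrier A" "y \<in> carrier A" "z \<in> carrier A"
  shows "(p \<oplus> y) \<odot> z \<preceq> p \<oplus> (y \<odot> z)"
proof -
  have "p \<oplus> y \<preceq> p \<oplus> (\<sim> z \<oplus> (y \<odot> z))"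
    using assms le_sup[of y "\<sim> z"] plus_mono[of p p y "\<sim> z \<oplus> (y \<odot> z)"] by simp
  then show ?thesis
    using assms residuation[of "p \<oplus> y" z "p \<oplus> (y \<odot> z)"] plus_left_comm[of p "\<sim> z"] by simp
qed

text \<open>This inequality is what makes adjoining an element to a filter produce a filter again, and
  what makes the congruence of a filter compatible with \<open>\<oplus>\<close>.\<close>

lemma plus_times_plus_le:
  assumes "p \<in> carrier A" "q \<in> carrier A" "y \<in> carrier A" "z \<in> carrier A"
  shows "(p \<oplus> y) \<odot> (q \<oplus> z) \<preceq> (p \<oplus> q) \<oplus> (y \<odot> z)"
proof -
  have a: "(p \<oplus> y) \<odot> (q \<oplus> z) \<preceq> p \<oplus> (y \<odot> (q \<oplus> z))"
    using assms by (intro plus_times_le) auto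
  have "y \<odot> (q \<oplus> z) \<preceq> q \<oplus> (y \<odot> z)"
    using assms plus_times_le[of q z y] times_comm[of y "q \<oplus> z"] times_comm[of y z] by simp
  then have "p \<oplus> (y \<odot> (q \<oplus> z)) \<preceq> p \<oplus> (q \<oplus> (y \<odot> z))"
    using assms by (intro plus_mono) auto
  with a show ?thesis
    using assms le_trans[of "(p \<oplus> y) \<odot> (q \<oplus> z)" "p \<oplus> (y \<odot> (q \<oplus> z))" "p \<oplus> (q \<oplus> (y \<odot> z))"]
    by (simp add: plus_assoc)
qed

text \<open>The hypothesis \<open>x \<preceq> \<sim> y\<close> says that the sum \<open>x \<oplus> y\<close> does not overflow; then \<open>y\<close> can be
  subtracted again. This form of cancellation replaces computations in an ordered group.\<close>

lemma neg_plus_cancel: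
  assumes "x \<in> carrier A" "y \<in> carrier A" "x \<preceq> \<sim> y"
  shows "\<sim> (x \<oplus> y) \<oplus> y = \<sim> x"
  using assms lukasiewicz[of "\<sim> x" y] plus_comm[of "\<sim> x" "\<sim> y"] by (simp add: mv_le_def)

text \<open>Sums without overflow are associative: if \<open>x + y\<close> and \<open>(x + y) + z\<close> stay below \<open>1\<close>, so does
  the sum of \<open>x\<close> and \<open>y + z\<close>.\<close>

lemma summable_assoc:
  assumes "x \<in> carrier A" "y \<in> carrier A" "z \<in> carrier A" "x \<preceq> \<sim> y" "x \<oplus> y \<preceq> \<sim> z"
  shows "x \<preceq> \<sim> (y \<oplus> z)"
proof -
  have "z \<preceq> \<sim> (x \<oplus> y)" using assms le_neg_comm by simp
  then have "z \<oplus> y \<preceq> \<sim> x"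
    using assms plus_mono_left[of z "\<sim> (x \<oplus> y)" y] neg_plus_cancel[of x y] by simp
  then show ?thesis
    using assms le_neg_comm[of "z \<oplus> y" x] plus_comm by simp
qed

text \<open>In \<open>[0, 1]\<close> either \<open>x \<odot> y = 0\<close> or \<open>x \<oplus> y = 1\<close>. In general, \<open>y\<close> is the sum of
  \<open>m = \<sim> x \<and> y\<close>, the part of \<open>y\<close> that fits on top of \<open>x\<close>, and of the excess \<open>x \<odot> y\<close>, while adding
  \<open>m\<close> to \<open>x\<close> already gives \<open>x \<oplus> y\<close>. It follows that quotients by maximal filters are chains.\<close>

lemma plus_times_absorb:
  assumes [simp]: "x \<in> carrier A" "y \<in> carrier A"
  shows "(x \<oplus> y) \<oplus> (x \<odot> y) = x \<oplus> y"
proof -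
  define m where "m = \<sim> x \<odot> (x \<oplus> y)"
  have m [simp]: "m \<in> carrier A" by (simp add: m_def)
  have 1: "x \<oplus> y = x \<oplus> m"
    using le_eq_plus_diff[of x "x \<oplus> y"] by (simp add: m_def le_plus times_comm)
  have "\<sim> m = x \<odot> y \<oplus> \<sim> y"
    using lukasiewicz[of "\<sim> y" x] plus_comm[of x y] plus_comm[of x "\<sim> (x \<oplus> y)"]
    by (simp add: m_def mv_times_def)
  then have "m = y \<odot> \<sim> (x \<odot> y)"
    using neg_inject[of m "y \<odot> \<sim> (x \<odot> y)"] neg_times[of y "\<sim> (x \<odot> y)"]
    by (simp add: plus_comm)
  moreover have "x \<odot> y \<preceq> y"
    using residuation[of x y y] by simp
  ultimately have "y = (x \<odot> y) \<oplus> m"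
    using le_eq_plus_diff[of "x \<odot> y" y] by simp
  then show ?thesis using 1 plus_ac by (metis assms m times_closed)
qed

end

section \<open>Binary expansions in MV-chains\<close>

lemma std_mv_simps [simp]:
  "carrier std_mv = {0..1}"
  "a \<oplus>\<^bsub>std_mv\<^esub> b = min 1 (a + b)"
  "\<sim>\<^bsub>std_mv\<^esub> a = 1 - a"
  "\<zero>\<^bsub>std_mv\<^esub> = 0"
  "\<one>\<^bsub>std_mv\<^esub> = 1"
  "a \<odot>\<^bsub>std_mv\<^esub> b = max 0 (a + b - 1)"
  by (auto simp: std_mv_def mv_one_def mv_times_def min_def max_def)

text \<open>Iterating the second hypothesis bounds \<open>f s\<close> by \<open>B / 2 ^ n\<close> for all \<open>n\<close>. The functions \<open>f\<close> of
  interest measure by how much a map fails to respect an operation.\<close>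

lemma vanishing_by_halving:
  fixes f :: "'b \<Rightarrow> real"
  assumes "\<And>s. s \<in> S \<Longrightarrow> f s \<le> B"
    and "\<And>s. s \<in> S \<Longrightarrow> f s \<le> 0 \<or> (\<exists>t\<in>S. f s \<le> f t / 2)"
    and "s \<in> S"
  shows "f s \<le> 0"
proof -
  have "f s \<le> 0 \<or> f s \<le> B / 2 ^ n" if "s \<in> S" for n s
    using that
  proof (induction n arbitrary: s)
    case 0
    then show ?case using assms(1) by simp
  next
    case (Suc n)
    show ?case
    proof (cases "f s \<le> 0")
      case False
      then obtain t where "t \<in> S" "f s \<le> f t / 2" using assms(2) Suc.prems by blast
      then show ?thesis using Suc.IH[of t] False by auto
    qed simp
  qed
  then have "f s \<le> 0 \<or> (\<forall>n. f s \<le> B / 2 ^ n)" using assms(3) by blast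
  moreover have "(\<lambda>n. B / 2 ^ n) \<longlonglongrightarrow> 0"
    by (rule LIMSEQ_divide_realpow_zero) simp
  ultimately show ?thesis
    using LIMSEQ_le_const[of "\<lambda>n. B / 2 ^ n" 0 "f s"] by auto
qed

locale mv_chain = mv_algebra +
  assumes linear: "\<lbrakk>x \<in> carrier A; y \<in> carrier A\<rbrakk> \<Longrightarrow> x \<preceq> y \<or> y \<preceq> x"
    and zero_neq_one: "\<zero> \<noteq> \<one>"
begin

text \<open>An element counts as at least one half if \<open>\<sim> x \<preceq> x\<close>. The map \<open>shift\<close> is \<open>x \<mapsto> 2 x\<close> modulo \<open>1\<close>,
  except that it fixes \<open>1\<close>. Of its two expansions, one half gets \<open>1, 0, 0, \<dots>\<close>.\<close>

definition digit :: "'a \<Rightarrow> real"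
  where "digit x = (if \<sim> x \<preceq> x then 1 else 0)"

definition shift :: "'a \<Rightarrow> 'a"
  where "shift x = (if \<sim> x \<preceq> x then x \<odot> x else x \<oplus> x)"

definition binary :: "'a \<Rightarrow> real"
  where "binary x = (\<Sum>n. digit ((shift ^^ n) x) / 2 ^ Suc n)"

lemma digit_bounds: "0 \<le> digit x" "digit x \<le> 1"
  by (auto simp: digit_def)

lemma summable_digits: "summable (\<lambda>n. digit ((shift ^^ n) x) / 2 ^ Suc n)"
proof (rule summable_comparison_test')
  show "summable (\<lambda>n. (1 / 2) ^ Suc n :: real)"
    using sums_summable[OF power_half_series] .
  show "norm (digit ((shift ^^ n) x) / 2 ^ Suc n) \<le> (1 / 2) ^ Suc n" for n
    using digit_bounds[of "(shift ^^ n) x"] by (simp add: field_simps)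
qed

lemma binary_bounds: "0 \<le> binary x" "binary x \<le> 1"
proof -
  show "0 \<le> binary x" unfolding binary_def
    using summable_digits digit_bounds by (intro suminf_nonneg) auto
  have "binary x \<le> (\<Sum>n. (1 / 2) ^ Suc n)" unfolding binary_def
    using sums_summable[OF power_half_series] digit_bounds(2)
    by (intro suminf_le summable_digits) (auto simp: field_simps)
  then show "binary x \<le> 1"
    using sums_unique[OF power_half_series] by simp
qed

lemma binary_shift: "binary x = (digit x + binary (shift x)) / 2"
proof -
  have "binary x = (\<Sum>n. digit ((shift ^^ Suc n) x) / 2 ^ Suc (Suc n)) + digit x / 2"
    using suminf_split_head[OF summable_digits[of x]] by (simp add: binary_def)
  also have "(\<Sum>n. digit ((shift ^^ Suc n) x) / 2 ^ Suc (Suc n)) = binary (shift x) / 2"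
    unfolding binary_def suminf_divide[OF summable_digits, symmetric]
    by (simp add: funpow_swap1 mult.commute)
  finally show ?thesis by simp
qed

lemma binary_high:
  "\<sim> x \<preceq> x \<Longrightarrow> binary x = (1 + binary (x \<odot> x)) / 2"
  using binary_shift[of x] by (simp add: digit_def shift_def)

lemma binary_low:
  "\<not> \<sim> x \<preceq> x \<Longrightarrow> binary x = binary (x \<oplus> x) / 2"
  using binary_shift[of x] by (simp add: digit_def shift_def)

lemma low_le_neg: "x \<in> carrier A \<Longrightarrow> \<not> \<sim> x \<preceq> x \<Longrightarrow> x \<preceq> \<sim> x"
  using linear[of x "\<sim> x"] by simp

lemma binary_zero [simp]: "binary \<zero> = 0"
proof -
  have "\<not> \<sim> \<zero> \<preceq> \<zero>"
    using zero_neq_one by (simp add: mv_le_def)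
  then show ?thesis using binary_low[of "\<zero>"] by simp
qed

text \<open>Negation exchanges the digits and commutes with \<open>shift\<close> except at one half, so the error at
  \<open>s\<close> is half the error at its shift.\<close>

lemma binary_neg:
  assumes "x \<in> carrier A"
  shows "binary (\<sim> x) = 1 - binary x"
proof -
  let ?f = "\<lambda>x. \<bar>binary x + binary (\<sim> x) - 1\<bar>"
  have "?f x \<le> 0" 
  proof (rule vanishing_by_halving[where f = ?f and S = "carrier A" and B = 1])
    show "?f s \<le> 1" for s
      using binary_bounds[of s] binary_bounds[of "\<sim> s"] by linarith
    show "?f s \<le> 0 \<or> (\<exists>t\<in>carrier A. ?f s \<le> ?f t / 2)" if [simp]: "s \<in> carrier A" for s
    proof -
      consider "\<sim> s \<preceq> s" "s \<preceq> \<sim> s" | "\<sim> s \<preceq> s" "\<not> s \<preceq> \<sim> s" | "\<not> \<sim> s \<preceq> s" "s \<preceq> \<sim> s"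
        using linear[of s "\<sim> s"] by auto
      then show ?thesis
      proof cases
        case 1
        then have eq: "\<sim> s = s" using le_antisym[of "\<sim> s" s] by simp
        then have "s \<odot> s = \<zero>" using plus_neg_self[of s] by (simp add: mv_times_def)
        then have "?f s \<le> 0" using binary_high[of s] 1 eq by simp
        then show ?thesis ..
      next
        case 2
        then have "?f s = ?f (s \<odot> s) / 2"
          using binary_high[of s] binary_low[of "\<sim> s"]
          by (auto simp: neg_times abs_if field_simps)
        then show ?thesis by (intro disjI2 bexI[of _ "s \<odot> s"]) auto
      next
        case 3
        then have "?f s = ?f (s \<oplus> s) / 2"
          using binary_low[of s] binary_high[of "\<sim> s"]
          by (auto simp: neg_plus abs_if field_simps)
        then show ?thesis by (intro disjI2 bexI[of _ "s \<oplus> s"]) auto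
      qed
    qed
  qed (fact assms)
  then show ?thesis by simp
qed

lemma binary_one [simp]: "binary \<one> = 1"
  using binary_neg[of "\<zero>"] by simp

text \<open>The sum of \<open>x\<close>, \<open>y\<close>, \<open>x\<close>, \<open>y\<close> does not overflow and can be regrouped by
  \<open>summable_assoc\<close>.\<close>

lemma double_summable:
  assumes [simp]: "x \<in> carrier A" "y \<in> carrier A"
    and xy: "x \<preceq> \<sim> y" and low: "x \<oplus> y \<preceq> \<sim> (x \<oplus> y)"
  shows "x \<oplus> x \<preceq> \<sim> (y \<oplus> y)"
proof -
  have "x \<preceq> \<sim> (y \<oplus> (x \<oplus> y))"
    using xy low summable_assoc[of x y "x \<oplus> y"] by simp
  then have 1: "x \<preceq> \<sim> ((y \<oplus> y) \<oplus> x)" by (simp add: plus_ac)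
  then have 2: "(y \<oplus> y) \<oplus> x \<preceq> \<sim> x" using le_neg_comm[of x "(y \<oplus> y) \<oplus> x"] by simp
  have "y \<oplus> y \<preceq> (y \<oplus> y) \<oplus> x" by (simp add: le_plus)
  then have "y \<oplus> y \<preceq> \<sim> x" using 2 le_trans[of "y \<oplus> y" "(y \<oplus> y) \<oplus> x" "\<sim> x"] by simp
  then have "y \<oplus> y \<preceq> \<sim> (x \<oplus> x)" using 2 summable_assoc[of "y \<oplus> y" x x] by simp
  then show ?thesis using le_neg_comm[of "y \<oplus> y" "x \<oplus> x"] by simp
qed

text \<open>For \<open>x\<close> and \<open>y\<close> below one half and \<open>z = \<sim> (x \<oplus> y)\<close>, the identity says
  \<open>(1 - 2 x) + (1 - 2 y) = 2 z\<close>. With \<open>x \<le> y\<close> and the difference \<open>w = y - x\<close>, the terms on the left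
  are \<open>z + w\<close> and \<open>z - w\<close>.\<close>

lemma square_plus:
  assumes [simp]: "x \<in> carrier A" "y \<in> carrier A"
    and x: "x \<preceq> \<sim> x" and y: "y \<preceq> \<sim> y"
  shows "(x \<oplus> y) \<odot> (x \<oplus> y) = (x \<oplus> x) \<odot> (y \<oplus> y)"
proof -
  have ordered: "(x \<oplus> y) \<odot> (x \<oplus> y) = (x \<oplus> x) \<odot> (y \<oplus> y)"
    if [simp]: "x \<in> carrier A" "y \<in> carrier A" and y: "y \<preceq> \<sim> y" and xy: "x \<preceq> y" for x y
  proof -
    define w where "w = y \<odot> \<sim> x"
    define z where "z = \<sim> (x \<oplus> y)"
    have [simp]: "w \<in> carrier A" "z \<in> carrier A" by (auto simp: w_def z_def)
    have yw: "y = x \<oplus> w" using le_eq_plus_diff[of x y] xy by (simp add: w_def)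
    have nw: "\<sim> w = \<sim> y \<oplus> x" by (simp add: w_def neg_times)
    have "x \<preceq> \<sim> y" using le_trans[of x y "\<sim> y"] xy y by simp
    then have "x \<oplus> x \<preceq> \<sim> w" by (simp add: nw plus_mono_left)
    then have "\<sim> (x \<oplus> x) = \<sim> ((x \<oplus> x) \<oplus> w) \<oplus> w" 
      using neg_plus_cancel[of "x \<oplus> x" w] by simp
    also have "(x \<oplus> x) \<oplus> w = x \<oplus> y" by (simp add: plus_assoc flip: yw)
    finally have p: "\<sim> (x \<oplus> x) = z \<oplus> w" by (simp add: z_def)
    have "y \<oplus> x \<preceq> \<sim> w" using y by (simp add: nw plus_mono_left)
    then have "\<sim> (y \<oplus> x) = \<sim> ((y \<oplus> x) \<oplus> w) \<oplus> w"
      using neg_plus_cancel[of "y \<oplus> x" w] by simp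
    also have "(y \<oplus> x) \<oplus> w = y \<oplus> y" by (simp add: plus_assoc flip: yw)
    finally have q: "\<sim> (y \<oplus> y) \<oplus> w = z" by (simp add: z_def plus_comm)
    have "\<sim> (x \<oplus> x) \<oplus> \<sim> (y \<oplus> y) = z \<oplus> (\<sim> (y \<oplus> y) \<oplus> w)"
      unfolding p by (simp add: plus_ac)
    then have "\<sim> (x \<oplus> x) \<oplus> \<sim> (y \<oplus> y) = \<sim> (x \<oplus> y) \<oplus> \<sim> (x \<oplus> y)"
      by (simp only: q z_def)
    then show ?thesis by (simp add: mv_times_def)
  qed
  show ?thesis
  proof (cases "x \<preceq> y")
    case False
    then have "y \<preceq> x" using linear[of x y] by simp
    then have "(y \<oplus> x) \<odot> (y \<oplus> x) = (y \<oplus> y) \<odot> (x \<oplus> x)"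
      using ordered[of y x] x by simp
    then show ?thesis
      by (metis assms(1,2) plus_closed plus_comm times_comm)
  qed (use ordered y in auto)
qed

text \<open>The digits of \<open>x\<close>, \<open>y\<close> and \<open>x \<oplus> y\<close> distinguish the cases. In each of them the error is zero or
  half the error at another pair of summands: at the pair of the shifts if the digits add up without
  a carry, and at the negations of \<open>x \<oplus> x\<close> and \<open>y \<oplus> y\<close> if two digits \<open>0\<close> produce a digit \<open>1\<close>.\<close>

lemma binary_plus_summable:
  assumes "x \<in> carrier A" "y \<in> carrier A" "x \<preceq> \<sim> y"
  shows "binary (x \<oplus> y) = binary x + binary y"
proof -
  let ?f = "\<lambda>(x, y). \<bar>binary (x \<oplus> y) - binary x - binary y\<bar>"
  let ?S = "{(x, y). x \<in> carrier A \<and> y \<in> carrier A \<and> x \<preceq> \<sim> y}"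
  \<comment> \<open>The first summand has digit \<open>1\<close> and the second one \<open>0\<close>. In \<open>z = 1 - x - y\<close> the claim is that
    \<open>1 - 2 z\<close> is the sum of \<open>2 x - 1 = 1 - 2 (z + y)\<close> and \<open>2 y\<close>.\<close>
  have mixed: "?f (x, y) = ?f (x \<odot> x, y \<oplus> y) / 2 \<and> (x \<odot> x, y \<oplus> y) \<in> ?S"
    if [simp]: "x \<in> carrier A" "y \<in> carrier A" and xy: "x \<preceq> \<sim> y"
      and x: "\<sim> x \<preceq> x" and y: "\<not> \<sim> y \<preceq> y" for x y
  proof -
    define z where "z = \<sim> (x \<oplus> y)"
    have [simp]: "z \<in> carrier A" by (simp add: z_def)
    have nx: "\<sim> x = z \<oplus> y" using neg_plus_cancel[of x y] xy by (simp add: z_def)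
    have "\<sim> (x \<oplus> y) \<preceq> \<sim> x" by (simp add: le_plus)
    then have "\<sim> (x \<oplus> y) \<preceq> x \<oplus> y"
      using x le_plus[of x y] le_trans[of "\<sim> (x \<oplus> y)" "\<sim> x" x] le_trans[of "\<sim> (x \<oplus> y)" x "x \<oplus> y"]
      by simp
    then have high: "binary (x \<oplus> y) = (1 + binary ((x \<oplus> y) \<odot> (x \<oplus> y))) / 2" by (rule binary_high)
    have "x = \<sim> (z \<oplus> y)" using nx neg_neg[of x] by simp
    then have "z \<oplus> y \<preceq> \<sim> (z \<oplus> y)" using x nx by simp
    moreover have "z \<preceq> \<sim> y" by (simp add: z_def le_plus_left)
    ultimately have "z \<oplus> z \<preceq> \<sim> (y \<oplus> y)" by (intro double_summable) auto
    then have "\<sim> ((z \<oplus> z) \<oplus> (y \<oplus> y)) \<oplus> (y \<oplus> y) = \<sim> (z \<oplus> z)"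
      by (intro neg_plus_cancel) auto
    moreover have "x \<odot> x = \<sim> ((z \<oplus> z) \<oplus> (y \<oplus> y))"
      by (simp add: mv_times_def nx plus_ac)
    moreover have "(x \<oplus> y) \<odot> (x \<oplus> y) = \<sim> (z \<oplus> z)" by (simp add: mv_times_def z_def)
    ultimately have sq: "(x \<oplus> y) \<odot> (x \<oplus> y) = x \<odot> x \<oplus> (y \<oplus> y)" 
      and "x \<odot> x \<preceq> \<sim> (y \<oplus> y)"
      by (simp_all add: le_plus_left)
    then show ?thesis
      using high binary_high[OF x] binary_low[OF y] by (auto simp: abs_if field_simps)
  qed
  have "?f (x, y) \<le> 0"
  proof (rule vanishing_by_halving[where f = ?f and S = ?S and B = 2])
    show "?f s \<le> 2" for s
      using binary_bounds[of "fst s \<oplus> snd s"] binary_bounds[of "fst s"] binary_bounds[of "snd s"]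
      by (auto simp: split_beta)
    show "?f s \<le> 0 \<or> (\<exists>t\<in>?S. ?f s \<le> ?f t / 2)" if "s \<in> ?S" for s
    proof -
      obtain x y where s: "s = (x, y)" by fastforce
      then have [simp]: "x \<in> carrier A" "y \<in> carrier A" and xy: "x \<preceq> \<sim> y" using that by auto
      consider (both_high) "\<sim> x \<preceq> x" "\<sim> y \<preceq> y" | (left) "\<sim> x \<preceq> x" "\<not> \<sim> y \<preceq> y"
        | (right) "\<not> \<sim> x \<preceq> x" "\<sim> y \<preceq> y" 
        | (sum_high) "\<not> \<sim> x \<preceq> x" "\<not> \<sim> y \<preceq> y" "\<sim> (x \<oplus> y) \<preceq> x \<oplus> y"
        | (sum_low) "\<not> \<sim> x \<preceq> x" "\<not> \<sim> y \<preceq> y" "\<not> \<sim> (x \<oplus> y) \<preceq> x \<oplus> y"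
        by blast
      then show ?thesis
      proof cases
        case both_high
        \<comment> \<open>Two summands of at least one half that do not overflow are complementary.\<close>
        have "\<sim> y \<preceq> x" using both_high xy le_neg_comm[of x y]
          le_trans[of "\<sim> y" y "\<sim> x"] le_trans[of "\<sim> y" "\<sim> x" x] by simp
        then have "x = \<sim> y" using xy by (intro le_antisym) auto
        then have "?f s \<le> 0" using binary_neg[of y] by (simp add: s)
        then show ?thesis ..
      next
        case left
        then show ?thesis using mixed[of x y] xy s 
          by (intro disjI2 bexI[of _ "(x \<odot> x, y \<oplus> y)"]) auto
      next
        case right
        moreover have "?f (x, y) = ?f (y, x)" by (simp add: plus_comm)
        ultimately show ?thesis using mixed[of y x] le_neg_comm[of x y] xy s
          by (intro disjI2 bexI[of _ "(y \<odot> y, x \<oplus> x)"]) auto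
      next
        case sum_high
        let ?t = "(\<sim> (x \<oplus> x), \<sim> (y \<oplus> y))"
        have "(x \<oplus> x) \<oplus> (y \<oplus> y) = \<one>"
          using sum_high(3) by (simp add: mv_le_def plus_ac)
        then have t: "?t \<in> ?S" by (simp add: mv_le_def)
        have "(x \<oplus> y) \<odot> (x \<oplus> y) = \<sim> (\<sim> (x \<oplus> x) \<oplus> \<sim> (y \<oplus> y))"
          using square_plus[of x y] sum_high low_le_neg by (simp add: mv_times_def)
        then have "binary (x \<oplus> y) = (2 - binary (\<sim> (x \<oplus> x) \<oplus> \<sim> (y \<oplus> y))) / 2"
          using binary_high[OF sum_high(3)] binary_neg by simp
        then have "?f s = ?f ?t / 2"
          using binary_low[OF sum_high(1)] binary_low[OF sum_high(2)] 
            binary_neg[of "x \<oplus> x"] binary_neg[of "y \<oplus> y"] by (auto simp: s abs_if field_simps)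
        then show ?thesis using t by (intro disjI2 bexI[of _ ?t]) auto
      next
        case sum_low
        let ?t = "(x \<oplus> x, y \<oplus> y)"
        have t: "?t \<in> ?S" using double_summable[of x y] xy low_le_neg[of "x \<oplus> y"] sum_low by simp
        have "(x \<oplus> y) \<oplus> (x \<oplus> y) = (x \<oplus> x) \<oplus> (y \<oplus> y)" by (simp add: plus_ac)
        then have "?f s = ?f ?t / 2"
          using binary_low[OF sum_low(1)] binary_low[OF sum_low(2)] binary_low[OF sum_low(3)]
          by (auto simp: s abs_if field_simps)
        then show ?thesis using t by (intro disjI2 bexI[of _ ?t]) auto
      qed
    qed
  qed (use assms in auto)
  then show ?thesis by simp
qed

lemma binary_plus:
  assumes [simp]: "x \<in> carrier A" "y \<in> carrier A"
  shows "binary (x \<oplus> y) = min 1 (binary x + binary y)"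
proof (cases "x \<preceq> \<sim> y")
  case True
  then show ?thesis using binary_plus_summable[of x y] binary_bounds(2)[of "x \<oplus> y"] by simp
next
  case False
  then have ge: "\<sim> y \<preceq> x" using linear[of x "\<sim> y"] by simp
  have "\<sim> y \<preceq> \<sim> (x \<odot> y)" 
    by (simp add: neg_times le_plus_left)
  then have "binary x = binary (\<sim> y) + binary (x \<odot> y)"
    using ge le_eq_plus_diff[of "\<sim> y" x] binary_plus_summable[of "\<sim> y" "x \<odot> y"] by simp
  moreover have "x \<oplus> y = \<one>" using ge by (simp add: mv_le_def plus_comm)
  ultimately show ?thesis using binary_neg[of y] binary_bounds(1)[of "x \<odot> y"] by simp
qed

lemma binary_hom: "binary \<in> mv_hom A std_mv"
proof -
  have "binary (x \<odot> y) = max 0 (binary x + binary y - 1)" 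
    if [simp]: "x \<in> carrier A" "y \<in> carrier A" for x y
    by (simp add: mv_times_def binary_neg binary_plus min_def max_def)
  then show ?thesis
    by (auto simp: mv_hom_def binary_plus binary_neg binary_bounds)
qed

end

section \<open>Separating reals by doubling and squaring\<close>

lemma mv_homD:
  assumes "h \<in> mv_hom A std_mv"
  shows "x \<in> carrier A \<Longrightarrow> 0 \<le> h x" "x \<in> carrier A \<Longrightarrow> h x \<le> 1"
    and "\<lbrakk>x \<in> carrier A; y \<in> carrier A\<rbrakk> \<Longrightarrow> h (x \<oplus>\<^bsub>A\<^esub> y) = min 1 (h x + h y)"
    and "\<lbrakk>x \<in> carrier A; y \<in> carrier A\<rbrakk> \<Longrightarrow> h (x \<odot>\<^bsub>A\<^esub> y) = max 0 (h x + h y - 1)"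
    and "x \<in> carrier A \<Longrightarrow> h (\<sim>\<^bsub>A\<^esub> x) = 1 - h x"
    and "h \<zero>\<^bsub>A\<^esub> = 0" "h \<one>\<^bsub>A\<^esub> = 1"
  using assms by (auto simp: mv_hom_def Pi_def)

text \<open>Morphisms are doubling maps, and so are the functions \<open>x \<mapsto> G x / U\<close>, which do not preserve sums
  in general. Both are treated by the same comparison principle.\<close>

definition doubling_map :: "('a, 'm) mv_struct_scheme \<Rightarrow> ('a \<Rightarrow> real) \<Rightarrow> bool"
  where "doubling_map A s \<longleftrightarrow> (\<forall>x\<in>carrier A. 0 \<le> s x \<and> s x \<le> 1
    \<and> s (x \<oplus>\<^bsub>A\<^esub> x) = s x \<oplus>\<^bsub>std_mv\<^esub> s x \<and> s (x \<odot>\<^bsub>A\<^esub> x) = s x \<odot>\<^bsub>std_mv\<^esub> s x)"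

lemma hom_doubling_map: "h \<in> mv_hom A std_mv \<Longrightarrow> doubling_map A h"
  by (simp add: doubling_map_def mv_homD)

text \<open>On \<open>[0, 1]\<close> the words of length \<open>n\<close> are the maps \<open>x \<mapsto> 2 ^ n * x - k\<close>, truncated to \<open>[0, 1]\<close>, for
  \<open>k < 2 ^ n\<close>.\<close>

primrec word :: "('a, 'm) mv_struct_scheme \<Rightarrow> bool list \<Rightarrow> 'a \<Rightarrow> 'a"
  where "word A [] x = x"
  | "word A (d # ds) x = word A ds (if d then x \<oplus>\<^bsub>A\<^esub> x else x \<odot>\<^bsub>A\<^esub> x)"

lemma (in mv_algebra) word_closed [simp]: "x \<in> carrier A \<Longrightarrow> word A ds x \<in> carrier A"
  by (induction ds arbitrary: x) auto

lemma doubling_map_word: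
  assumes "mv_algebra A" "doubling_map A s" "x \<in> carrier A"
  shows "s (word A ds x) = word std_mv ds (s x)"
proof -
  interpret mv_algebra A by fact
  show ?thesis using assms(3)
  proof (induction ds arbitrary: x)
    case (Cons d ds)
    then show ?case using assms(2) Cons.IH[of "x \<oplus>\<^bsub>A\<^esub> x"] Cons.IH[of "x \<odot>\<^bsub>A\<^esub> x"]
      by (simp add: doubling_map_def)
  qed simp
qed

lemma word_std_mono: "a \<le> b \<Longrightarrow> word std_mv ds a \<le> word std_mv ds b"
  by (induction ds arbitrary: a b) auto

text \<open>Squaring fixes \<open>1\<close> and doubles the distance to it until \<open>0\<close> is reached.\<close>

lemma separating_word_one:
  assumes "a < 1"
  shows "\<exists>ds. word std_mv ds a = 0 \<and> word std_mv ds 1 = 1"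
proof -
  have "\<exists>ds. word std_mv ds a = 0 \<and> word std_mv ds 1 = 1" if "1 \<le> 2 ^ n * (1 - a)" for n a
    using that
  proof (induction n arbitrary: a)
    case 0
    then show ?case by (intro exI[of _ "[False]"]) auto
  next
    case (Suc n)
    show ?case
    proof (cases "a \<le> 1 / 2")
      case True
      then show ?thesis by (intro exI[of _ "[False]"]) auto
    next
      case False
      then have "1 \<le> 2 ^ n * (1 - (2 * a - 1))" using Suc.prems by (simp add: algebra_simps)
      then obtain ds where "word std_mv ds (2 * a - 1) = 0" "word std_mv ds 1 = 1"
        using Suc.IH by blast
      then show ?thesis using False by (intro exI[of _ "False # ds"]) auto
    qed
  qed
  moreover obtain n where "1 / (1 - a) < 2 ^ n"
    using real_arch_pow[of 2 "1 / (1 - a)"] by auto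
  then have "1 \<le> 2 ^ n * (1 - a)" using assms by (simp add: field_simps)
  ultimately show ?thesis by blast
qed

text \<open>Double while both numbers are at most one half and square while both are at least one half:
  each step doubles their distance. When one half lies strictly between them, doubling sends the
  larger one to \<open>1\<close>, and repeated squaring does the rest.\<close>

lemma separating_word:
  assumes "0 \<le> a" "a < b" "b \<le> 1"
  shows "\<exists>ds. word std_mv ds a = 0 \<and> word std_mv ds b = 1"
proof -
  have "\<exists>ds. word std_mv ds a = 0 \<and> word std_mv ds b = 1"
    if "0 \<le> a" "a < b" "b \<le> 1" "1 \<le> 2 ^ n * (b - a)" for n a b
    using that
  proof (induction n arbitrary: a b)
    case 0
    then show ?case by (intro exI[of _ "[]"]) auto
  next
    case (Suc n)
    consider "b \<le> 1 / 2" | "1 / 2 \<le> a" | "a < 1 / 2" "1 / 2 < b" by linarith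
    then show ?case
    proof cases
      case 1
      then obtain ds where "word std_mv ds (2 * a) = 0" "word std_mv ds (2 * b) = 1"
        using Suc.IH[of "2 * a" "2 * b"] Suc.prems by (auto simp: algebra_simps)
      then show ?thesis using 1 Suc.prems by (intro exI[of _ "True # ds"]) auto
    next
      case 2
      then obtain ds where "word std_mv ds (2 * a - 1) = 0" "word std_mv ds (2 * b - 1) = 1"
        using Suc.IH[of "2 * a - 1" "2 * b - 1"] Suc.prems by (auto simp: algebra_simps)
      then show ?thesis using 2 Suc.prems by (intro exI[of _ "False # ds"]) auto
    next
      case 3
      then obtain ds where "word std_mv ds (2 * a) = 0" "word std_mv ds 1 = 1"
        using separating_word_one[of "2 * a"] by auto
      then show ?thesis using 3 by (intro exI[of _ "True # ds"]) auto
    qed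
  qed
  moreover obtain n where "1 / (b - a) < 2 ^ n"
    using real_arch_pow[of 2 "1 / (b - a)"] by auto
  then have "1 \<le> 2 ^ n * (b - a)" using assms by (simp add: field_simps)
  ultimately show ?thesis using assms by blast
qed

text \<open>If \<open>s' x < s x\<close>, a word separating these values gives an element at which \<open>s\<close> is \<open>1\<close> and \<open>s'\<close>
  is \<open>0\<close>.\<close>

lemma doubling_map_le:
  assumes "mv_algebra A" "doubling_map A s" "doubling_map A s'"
    and one: "\<And>y. \<lbrakk>y \<in> carrier A; s y = 1\<rbrakk> \<Longrightarrow> s' y = 1"
    and x: "x \<in> carrier A"
  shows "s x \<le> s' x"
proof (rule ccontr)
  interpret mv_algebra A by fact
  assume "\<not> s x \<le> s' x"
  then obtain ds where "word std_mv ds (s' x) = 0" "word std_mv ds (s x) = 1"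
    using separating_word[of "s' x" "s x"] assms by (auto simp: doubling_map_def)
  then have "s' (word A ds x) = 0" "s (word A ds x) = 1"
    using doubling_map_word assms by metis+
  then show False using one[of "word A ds x"] x by simp
qed

section \<open>Maximal filters\<close>

context mv_algebra
begin

definition multiple :: "nat \<Rightarrow> 'a \<Rightarrow> 'a"
  where "multiple n x = ((\<lambda>y. x \<oplus> y) ^^ n) \<zero>"

lemma multiple_0 [simp]: "multiple 0 x = \<zero>"
  by (simp add: multiple_def)

lemma multiple_Suc [simp]: "multiple (Suc n) x = x \<oplus> multiple n x"
  by (simp add: multiple_def)

lemma multiple_closed [simp]: "x \<in> carrier A \<Longrightarrow> multiple n x \<in> carrier A"
  by (induction n) auto

lemma multiple_add:
  "x \<in> carrier A \<Longrightarrow> multiple (m + n) x = multiple m x \<oplus> multiple n x"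
  by (induction m) (auto simp: plus_assoc)

lemma filterD:
  assumes "mv_filter A F"
  shows "x \<in> F \<Longrightarrow> x \<in> carrier A" and "\<one> \<in> F"
    and "\<lbrakk>x \<in> F; y \<in> carrier A; x \<preceq> y\<rbrakk> \<Longrightarrow> y \<in> F"
    and "\<lbrakk>x \<in> F; y \<in> F\<rbrakk> \<Longrightarrow> x \<odot> y \<in> F"
  using assms by (auto simp: mv_filter_def)

text \<open>This is the filter generated by \<open>F\<close> and \<open>b\<close>: the condition \<open>u \<odot> b \<odot> \<dots> \<odot> b \<preceq> y\<close> for some
  \<open>u \<in> F\<close> is residuated so that only multiples of \<open>\<sim> b\<close> occur.\<close>

definition filter_adjoin :: "'a set \<Rightarrow> 'a \<Rightarrow> 'a set"
  where "filter_adjoin F b = {y \<in> carrier A. \<exists>n. multiple n (\<sim> b) \<oplus> y \<in> F}"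

lemma filter_adjoin:
  assumes F: "mv_filter A F" and b [simp]: "b \<in> carrier A"
  shows "mv_filter A (filter_adjoin F b)" "F \<subseteq> filter_adjoin F b" "b \<in> filter_adjoin F b"
proof -
  show "F \<subseteq> filter_adjoin F b"
  proof
    fix y assume y: "y \<in> F"
    then have "multiple 0 (\<sim> b) \<oplus> y \<in> F" using filterD(1)[OF F] by simp
    then show "y \<in> filter_adjoin F b" using filterD(1)[OF F y] unfolding filter_adjoin_def by blast
  qed
  have "multiple 1 (\<sim> b) \<oplus> b \<in> F" using filterD(2)[OF F] by simp
  then show "b \<in> filter_adjoin F b" using b unfolding filter_adjoin_def by blast
  show "mv_filter A (filter_adjoin F b)"
    unfolding mv_filter_def
  proof (intro conjI ballI impI)
    show "filter_adjoin F b \<subseteq> carrier A" by (auto simp: filter_adjoin_def)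
    show "\<one> \<in> filter_adjoin F b" using \<open>F \<subseteq> filter_adjoin F b\<close> filterD(2)[OF F] by auto
  next
    fix y z assume y: "y \<in> filter_adjoin F b" and z: "z \<in> carrier A" "y \<preceq> z"
    then obtain n where n: "multiple n (\<sim> b) \<oplus> y \<in> F" "y \<in> carrier A"
      by (auto simp: filter_adjoin_def)
    then have "multiple n (\<sim> b) \<oplus> z \<in> F"
      using filterD(3)[OF F n(1), of "multiple n (\<sim> b) \<oplus> z"] z 
        plus_mono[of "multiple n (\<sim> b)" "multiple n (\<sim> b)" y z] by simp
    then show "z \<in> filter_adjoin F b" using z unfolding filter_adjoin_def by blast
  next
    fix y z assume "y \<in> filter_adjoin F b" "z \<in> filter_adjoin F b"
    then obtain m n where m: "multiple m (\<sim> b) \<oplus> y \<in> F" and n: "multiple n (\<sim> b) \<oplus> z \<in> F"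
      and [simp]: "y \<in> carrier A" "z \<in> carrier A"
      by (auto simp: filter_adjoin_def)
    have "multiple (m + n) (\<sim> b) \<oplus> y \<odot> z \<in> F"
      using filterD(3)[OF F filterD(4)[OF F m n], of "multiple (m + n) (\<sim> b) \<oplus> y \<odot> z"]
      by (simp add: multiple_add plus_times_plus_le)
    then show "y \<odot> z \<in> filter_adjoin F b"
      unfolding filter_adjoin_def by (intro CollectI conjI times_closed exI) simp_all
  qed
qed

lemma zero_in_filter_adjoin:
  "b \<in> carrier A \<Longrightarrow> \<zero> \<in> filter_adjoin F b \<longleftrightarrow> (\<exists>n. multiple n (\<sim> b) \<in> F)"
  by (simp add: filter_adjoin_def)

lemma max_filterD:
  assumes "U \<in> max_filters A"
  shows "mv_filter A U" "\<zero> \<notin> U" "\<lbrakk>mv_filter A F; \<zero> \<notin> F; U \<subseteq> F\<rbrakk> \<Longrightarrow> F = U"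
  using assms by (auto simp: max_filters_def proper_mv_filter_def)

lemma max_filter_extension:
  assumes "proper_mv_filter A F"
  obtains U where "U \<in> max_filters A" "F \<subseteq> U"
proof -
  let ?P = "{V. proper_mv_filter A V \<and> F \<subseteq> V}"
  have "\<exists>M\<in>?P. \<forall>X\<in>?P. M \<subseteq> X \<longrightarrow> X = M"
  proof (rule subset_Zorn_nonempty)
    show "?P \<noteq> {}" using assms by auto
    fix C assume "C \<noteq> {}" and C: "subset.chain ?P C"
    then have sub: "C \<subseteq> ?P"
      and chain: "\<And>V W. \<lbrakk>V \<in> C; W \<in> C\<rbrakk> \<Longrightarrow> V \<subseteq> W \<or> W \<subseteq> V"
      unfolding subset_chain_def by blast+
    have proper: "\<And>V. V \<in> C \<Longrightarrow> proper_mv_filter A V" and "F \<subseteq> \<Union>C"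
      using sub \<open>C \<noteq> {}\<close> by auto
    have "mv_filter A (\<Union>C)"
      unfolding mv_filter_def
    proof (intro conjI ballI impI)
      show "\<Union>C \<subseteq> carrier A" using proper unfolding proper_mv_filter_def mv_filter_def by blast
      show "\<one> \<in> \<Union>C" using proper \<open>C \<noteq> {}\<close> by (auto simp: proper_mv_filter_def mv_filter_def)
    next
      fix x y assume "x \<in> \<Union>C" "y \<in> carrier A" "x \<preceq> y"
      then show "y \<in> \<Union>C" using proper unfolding proper_mv_filter_def mv_filter_def by blast
    next
      fix x y assume "x \<in> \<Union>C" "y \<in> \<Union>C"
      then obtain V W where VW: "V \<in> C" "W \<in> C" "x \<in> V" "y \<in> W" by auto
      then obtain Z where "Z \<in> C" "x \<in> Z" "y \<in> Z" using chain[of V W] by blast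
      then show "x \<odot> y \<in> \<Union>C" using proper unfolding proper_mv_filter_def mv_filter_def by blast
    qed
    then show "\<Union>C \<in> ?P" 
      using proper \<open>F \<subseteq> \<Union>C\<close> by (auto simp: proper_mv_filter_def)
  qed
  then obtain U where "U \<in> ?P" "\<forall>X\<in>?P. U \<subseteq> X \<longrightarrow> X = U" by blast
  then have "U \<in> max_filters A" "F \<subseteq> U" by (auto simp: max_filters_def)
  then show thesis by (rule that)
qed

lemma max_filter_adjoin:
  assumes "mv_filter A F" "c \<in> carrier A" "\<And>n. multiple n c \<notin> F"
  obtains U where "U \<in> max_filters A" "F \<subseteq> U" "\<sim> c \<in> U"
proof -
  have "proper_mv_filter A (filter_adjoin F (\<sim> c))"
    using assms filter_adjoin[of F "\<sim> c"] zero_in_filter_adjoin[of "\<sim> c"]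
    by (simp add: proper_mv_filter_def)
  then obtain U where "U \<in> max_filters A" "filter_adjoin F (\<sim> c) \<subseteq> U"
    by (rule max_filter_extension)
  then show thesis using that[of U] filter_adjoin[of F "\<sim> c"] assms by auto
qed

text \<open>By maximality, adjoining \<open>\<sim> x\<close> to \<open>U\<close> gives the improper filter.\<close>

lemma max_filter_archimedean:
  assumes U: "U \<in> max_filters A" and x: "x \<in> carrier A" "\<sim> x \<notin> U"
  obtains n where "multiple n x \<in> U"
proof -
  note F = filter_adjoin[OF max_filterD(1)[OF U], of "\<sim> x"]
  have "\<zero> \<in> filter_adjoin U (\<sim> x)"
    using max_filterD(3)[OF U, of "filter_adjoin U (\<sim> x)"] F x by auto
  then show thesis using zero_in_filter_adjoin[of "\<sim> x"] x that by auto
qed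

section \<open>Quotients by maximal filters\<close>

text \<open>Transitivity of the congruence of a filter, as an inequality.\<close>

lemma imp_trans:
  assumes "x \<in> carrier A" "y \<in> carrier A" "z \<in> carrier A"
  shows "(\<sim> x \<oplus> y) \<odot> (\<sim> y \<oplus> z) \<preceq> \<sim> x \<oplus> z"
proof -
  have "y \<odot> (\<sim> y \<oplus> z) \<preceq> z"
    using assms residuation[of "\<sim> y \<oplus> z" y z] times_comm[of y "\<sim> y \<oplus> z"] by simp
  then have "\<sim> x \<oplus> y \<odot> (\<sim> y \<oplus> z) \<preceq> \<sim> x \<oplus> z" using assms by (intro plus_mono) auto
  moreover have "(\<sim> x \<oplus> y) \<odot> (\<sim> y \<oplus> z) \<preceq> \<sim> x \<oplus> y \<odot> (\<sim> y \<oplus> z)"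
    using assms by (intro plus_times_le) auto
  ultimately show ?thesis using assms
    le_trans[of "(\<sim> x \<oplus> y) \<odot> (\<sim> y \<oplus> z)" "\<sim> x \<oplus> y \<odot> (\<sim> y \<oplus> z)" "\<sim> x \<oplus> z"] by simp
qed

text \<open>Compatibility of the congruence of a filter with sums, as an inequality.\<close>

lemma imp_plus:
  assumes "x \<in> carrier A" "y \<in> carrier A" "z \<in> carrier A"
  shows "\<sim> x \<oplus> y \<preceq> \<sim> (x \<oplus> z) \<oplus> (y \<oplus> z)"
proof -
  have "x \<odot> \<sim> x = \<zero>" using assms by (simp add: mv_times_def)
  then have "(y \<oplus> \<sim> x) \<odot> (z \<oplus> x) \<preceq> y \<oplus> z"
    using assms plus_times_plus_le[of y z "\<sim> x" x] times_comm[of "\<sim> x" x] by simp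
  then show ?thesis
    using assms residuation[of "y \<oplus> \<sim> x" "z \<oplus> x" "y \<oplus> z"] 
    by (simp add: plus_comm[of "\<sim> x" y] plus_comm[of x z])
qed

lemma equiv_filter_cong:
  assumes F: "mv_filter A F"
  shows "equiv (carrier A) (filter_cong A F)"
proof (rule equivI)
  show "filter_cong A F \<subseteq> carrier A \<times> carrier A" by (auto simp: filter_cong_def)
  show "refl_on (carrier A) (filter_cong A F)"
    using filterD(2)[OF F] by (auto simp: filter_cong_def refl_on_def)
  show "sym (filter_cong A F)" by (auto simp: filter_cong_def sym_def)
  have "\<sim> x \<oplus> z \<in> F"
    if [simp]: "x \<in> carrier A" "y \<in> carrier A" "z \<in> carrier A" 
      and xy: "\<sim> x \<oplus> y \<in> F" "\<sim> y \<oplus> z \<in> F" for x y z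
    using filterD(3)[OF F filterD(4)[OF F xy]] imp_trans[of x y z] by simp
  then show "trans (filter_cong A F)" unfolding filter_cong_def trans_def by blast
qed

lemma filter_cong_neg:
  "(x, y) \<in> filter_cong A F \<Longrightarrow> (\<sim> x, \<sim> y) \<in> filter_cong A F"
  by (auto simp: filter_cong_def plus_comm)

lemma filter_cong_plus:
  assumes F: "mv_filter A F" 
    and "(x, x') \<in> filter_cong A F" "(y, y') \<in> filter_cong A F"
  shows "(x \<oplus> y, x' \<oplus> y') \<in> filter_cong A F"
proof -
  have right: "(x \<oplus> y, x' \<oplus> y) \<in> filter_cong A F"
    if "(x, x') \<in> filter_cong A F" "y \<in> carrier A" for x x' y
    using that filterD(3)[OF F _ _ imp_plus[of x x' y]] filterD(3)[OF F _ _ imp_plus[of x' x y]]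
    by (auto simp: filter_cong_def)
  have "(x \<oplus> y, x' \<oplus> y) \<in> filter_cong A F" "(x' \<oplus> y, x' \<oplus> y') \<in> filter_cong A F"
    using right[of x x' y] right[of y y' x'] assms by (auto simp: filter_cong_def plus_comm)
  then show ?thesis using equiv_filter_cong[OF F] by (meson equivE transD)
qed

abbreviation (input) filter_class :: "'a set \<Rightarrow> 'a \<Rightarrow> 'a set"
  where "filter_class F x \<equiv> filter_cong A F `` {x}"

context
  fixes F assumes F: "mv_filter A F"
begin

lemma quotient_carrier: "carrier (mv_quotient A F) = filter_class F ` carrier A"
  by (auto simp: mv_quotient_def quotient_def)

lemma quotient_plus:
  assumes "x \<in> carrier A" "y \<in> carrier A"
  shows "filter_class F x \<oplus>\<^bsub>mv_quotient A F\<^esub> filter_class F y = filter_class F (x \<oplus> y)"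
proof -
  note eq = equiv_filter_cong[OF F]
  have "congruent2 (filter_cong A F) (filter_cong A F) (\<lambda>x y. filter_class F (x \<oplus> y))"
    using filter_cong_plus[OF F] equiv_class_eq[OF eq] by (intro congruent2I') blast
  from UN_equiv_class2[OF eq eq this] show ?thesis
    using assms by (simp add: mv_quotient_def)
qed

lemma quotient_neg:
  assumes "x \<in> carrier A"
  shows "\<sim>\<^bsub>mv_quotient A F\<^esub> filter_class F x = filter_class F (\<sim> x)"
proof -
  note eq = equiv_filter_cong[OF F]
  have "congruent (filter_cong A F) (\<lambda>x. filter_class F (\<sim> x))"
    using filter_cong_neg equiv_class_eq[OF eq] by (intro congruentI) blast
  from UN_equiv_class[OF eq this] show ?thesis
    using assms by (simp add: mv_quotient_def)
qed

lemma quotient_zero: "\<zero>\<^bsub>mv_quotient A F\<^esub> = filter_class F \<zero>"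
  by (simp add: mv_quotient_def)

lemma quotient_one: "\<one>\<^bsub>mv_quotient A F\<^esub> = filter_class F \<one>"
  by (simp add: mv_one_def[of "mv_quotient A F"] quotient_zero quotient_neg)

lemmas quotient_simps = quotient_plus quotient_neg quotient_zero quotient_one

lemma quotient_times:
  "\<lbrakk>x \<in> carrier A; y \<in> carrier A\<rbrakk>
    \<Longrightarrow> filter_class F x \<odot>\<^bsub>mv_quotient A F\<^esub> filter_class F y = filter_class F (x \<odot> y)"
  by (simp add: mv_times_def quotient_simps)

lemma class_eq_iff:
  "\<lbrakk>x \<in> carrier A; y \<in> carrier A\<rbrakk>
    \<Longrightarrow> filter_class F x = filter_class F y \<longleftrightarrow> \<sim> x \<oplus> y \<in> F \<and> \<sim> y \<oplus> x \<in> F"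
  using eq_equiv_class_iff[OF equiv_filter_cong[OF F]] by (auto simp: filter_cong_def)

lemma class_eq_one_iff: "x \<in> carrier A \<Longrightarrow> filter_class F x = filter_class F \<one> \<longleftrightarrow> x \<in> F"
  by (simp add: class_eq_iff filterD(2)[OF F])

lemma quotient_mv_algebra: "mv_algebra (mv_quotient A F)"
proof -
  have "\<sim> (\<sim> x \<oplus> y) \<oplus> y = \<sim> (\<sim> y \<oplus> x) \<oplus> x" if "x \<in> carrier A" "y \<in> carrier A" for x y
    using that by (rule lukasiewicz)
  then show ?thesis
    by unfold_locales
      (auto simp: quotient_carrier quotient_simps plus_assoc, (metis plus_comm)+)
qed

lemma quotient_le_iff:
  "\<lbrakk>x \<in> carrier A; y \<in> carrier A\<rbrakk>
    \<Longrightarrow> filter_class F x \<preceq>\<^bsub>mv_quotient A F\<^esub> filter_class F y \<longleftrightarrow> \<sim> x \<oplus> y \<in> F"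
  by (simp add: mv_le_def quotient_simps class_eq_one_iff)

end

end

context mv_algebra
begin

text \<open>If \<open>\<sim> y \<oplus> x\<close> is not in \<open>U\<close>, some multiple of \<open>y \<odot> \<sim> x\<close> is. All these multiples lie below
  \<open>\<sim> x \<oplus> y\<close>, since the latter absorbs \<open>y \<odot> \<sim> x\<close> as a summand.\<close>

lemma max_filter_linear:
  assumes U: "U \<in> max_filters A" and [simp]: "x \<in> carrier A" "y \<in> carrier A"
  shows "\<sim> x \<oplus> y \<in> U \<or> \<sim> y \<oplus> x \<in> U"
proof (rule disjCI)
  assume not: "\<sim> y \<oplus> x \<notin> U"
  have "\<sim> (y \<odot> \<sim> x) \<notin> U" using not by (simp add: neg_times)
  then obtain n where n: "multiple n (y \<odot> \<sim> x) \<in> U"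
    using max_filter_archimedean[OF U, of "y \<odot> \<sim> x"] by auto
  have absorb: "(\<sim> x \<oplus> y) \<oplus> (y \<odot> \<sim> x) = \<sim> x \<oplus> y"
    using plus_times_absorb[of y "\<sim> x"] by (simp add: plus_comm)
  have "(\<sim> x \<oplus> y) \<oplus> multiple k (y \<odot> \<sim> x) = \<sim> x \<oplus> y" for k
  proof (induction k)
    case (Suc k)
    then show ?case
      using plus_assoc[of "\<sim> x \<oplus> y" "y \<odot> \<sim> x" "multiple k (y \<odot> \<sim> x)"] absorb by simp
  qed simp
  then have "multiple n (y \<odot> \<sim> x) \<preceq> \<sim> x \<oplus> y"
    using le_plus_left[of "multiple n (y \<odot> \<sim> x)" "\<sim> x \<oplus> y"] by simp
  then show "\<sim> x \<oplus> y \<in> U"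
    using filterD(3)[OF max_filterD(1)[OF U] n] by simp
qed

lemma quotient_mv_chain:
  assumes U: "U \<in> max_filters A"
  shows "mv_chain (mv_quotient A U)"
proof -
  note F = max_filterD(1)[OF U]
  interpret Q: mv_algebra "mv_quotient A U" by (rule quotient_mv_algebra[OF F])
  show ?thesis
  proof unfold_locales
    show "\<zero>\<^bsub>mv_quotient A U\<^esub> \<noteq> \<one>\<^bsub>mv_quotient A U\<^esub>"
      using class_eq_one_iff[OF F, of "\<zero>"] max_filterD(2)[OF U]
      by (simp add: quotient_zero[OF F] quotient_one[OF F])
  next
    fix X Y assume "X \<in> carrier (mv_quotient A U)" "Y \<in> carrier (mv_quotient A U)"
    then obtain x y where "x \<in> carrier A" "y \<in> carrier A" "X = filter_class U x" "Y = filter_class U y"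
      by (auto simp: quotient_carrier[OF F])
    then show "X \<preceq>\<^bsub>mv_quotient A U\<^esub> Y \<or> Y \<preceq>\<^bsub>mv_quotient A U\<^esub> X"
      using max_filter_linear[OF U, of x y] by (simp add: quotient_le_iff[OF F])
  qed
qed

lemma hom_of_quotient:
  assumes F: "mv_filter A F" and h: "h \<in> mv_hom (mv_quotient A F) std_mv"
  shows "(\<lambda>x. h (filter_class F x)) \<in> mv_hom A std_mv"
proof -
  have c: "filter_class F x \<in> carrier (mv_quotient A F)" if "x \<in> carrier A" for x
    using that by (simp add: quotient_carrier[OF F])
  show ?thesis
    using mv_homD[OF h] c
    unfolding mv_hom_def[of A]
    by (auto simp flip: quotient_simps[OF F] quotient_times[OF F] simp del: max.absorb1 max.absorb2)
qed

text \<open>The elements sent to \<open>1\<close> form a proper filter containing \<open>U\<close>, so they form \<open>U\<close> itself.\<close>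

lemma quotient_hom_eq_one_iff:
  assumes U: "U \<in> max_filters A" and h: "h \<in> mv_hom (mv_quotient A U) std_mv"
    and x: "x \<in> carrier A"
  shows "h (filter_class U x) = 1 \<longleftrightarrow> x \<in> U"
proof -
  note F = max_filterD(1)[OF U]
  let ?g = "\<lambda>x. h (filter_class U x)"
  note g = mv_homD[OF hom_of_quotient[OF F h]]
  let ?K = "{y \<in> carrier A. ?g y = 1}"
  have one: "?g y = 1" if "y \<in> U" for y
    using that class_eq_one_iff[OF F, of y] filterD(1)[OF F that] g(7) by simp
  have mono: "?g y \<le> ?g z" if "y \<in> carrier A" "z \<in> carrier A" "y \<preceq> z" for y z
    using that g(3)[of "\<sim> y" z] g(5)[of y] g(7) by (simp add: mv_le_def)
  have "mv_filter A ?K"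
    unfolding mv_filter_def
  proof (intro conjI ballI impI)
    show "\<one> \<in> ?K" using g(7) by simp
  next
    fix y z assume "y \<in> ?K" "z \<in> carrier A" "y \<preceq> z"
    then show "z \<in> ?K" using mono[of y z] g(2)[of z] by simp
  qed (use g(4) in auto)
  moreover have "\<zero> \<notin> ?K" using g(6) by simp
  moreover have "U \<subseteq> ?K" using one filterD(1)[OF F] by auto
  ultimately have "?K = U" using max_filterD(3)[OF U] by blast
  then show ?thesis using x by blast
qed

lemma quotient_hom_inj:
  assumes U: "U \<in> max_filters A" and h: "h \<in> mv_hom (mv_quotient A U) std_mv"
  shows "inj_on h (carrier (mv_quotient A U))"
proof -
  note F = max_filterD(1)[OF U]
  note g = mv_homD[OF hom_of_quotient[OF F h]]
  have "\<sim> x \<oplus> y \<in> U"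
    if "x \<in> carrier A" "y \<in> carrier A" "h (filter_class U x) = h (filter_class U y)" for x y
    using that quotient_hom_eq_one_iff[OF U h, of "\<sim> x \<oplus> y"] g(3)[of "\<sim> x" y] g(5)[of x] by simp
  then have "filter_class U x = filter_class U y"
    if "x \<in> carrier A" "y \<in> carrier A" "h (filter_class U x) = h (filter_class U y)" for x y
    using that by (simp add: class_eq_iff[OF F])
  then show ?thesis
    unfolding quotient_carrier[OF F] by (intro inj_onI) auto
qed

text \<open>Two morphisms on the quotient are \<open>1\<close> on the same elements, so the comparison principle
  applies in both directions.\<close>

lemma quotient_hom_unique:
  assumes U: "U \<in> max_filters A" 
    and h: "h \<in> mv_hom (mv_quotient A U) std_mv" and k: "k \<in> mv_hom (mv_quotient A U) std_mv"
    and X: "X \<in> carrier (mv_quotient A U)"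
  shows "h X = k X"
proof -
  note F = max_filterD(1)[OF U]
  obtain x where x: "x \<in> carrier A" and X: "X = filter_class U x"
    using X by (auto simp: quotient_carrier[OF F])
  have "h' (filter_class U x) \<le> k' (filter_class U x)"
    if h': "h' \<in> mv_hom (mv_quotient A U) std_mv" and k': "k' \<in> mv_hom (mv_quotient A U) std_mv"
    for h' k'
    by (rule doubling_map_le[OF mv_algebra_axioms hom_doubling_map[OF hom_of_quotient[OF F h']]
          hom_doubling_map[OF hom_of_quotient[OF F k']] _ x])
      (simp add: quotient_hom_eq_one_iff[OF U h'] quotient_hom_eq_one_iff[OF U k'])
  from this[OF h k] this[OF k h] show ?thesis by (simp add: X)
qed

text \<open>Existence comes from binary expansions and uniqueness from the comparison principle, so the
  definite description in \<open>quotient_emb\<close> denotes.\<close>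

lemma quotient_emb_hom:
  assumes U: "U \<in> max_filters A"
  shows "quotient_emb A U \<in> mv_hom (mv_quotient A U) std_mv"
proof -
  let ?Q = "mv_quotient A U"
  let ?P = "\<lambda>h. h \<in> mv_hom ?Q std_mv \<and> inj_on h (carrier ?Q) \<and> h \<in> extensional (carrier ?Q)"
  interpret Q: mv_chain ?Q by (rule quotient_mv_chain[OF U])
  let ?h = "restrict Q.binary (carrier ?Q)"
  have hom: "?h \<in> mv_hom ?Q std_mv"
    using Q.binary_hom by (auto simp: mv_hom_def)
  then have "?P ?h" using quotient_hom_inj[OF U hom] restrict_extensional by blast
  moreover have "h = ?h" if "?P h" for h
    using that by (intro extensionalityI[of _ "carrier ?Q"] quotient_hom_unique[OF U _ hom]) auto
  ultimately have "?P (THE h. ?P h)" by (rule theI)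
  then show ?thesis by (simp add: quotient_emb_def)
qed

lemma quotient_val_hom: "U \<in> max_filters A \<Longrightarrow> quotient_val A U \<in> mv_hom A std_mv"
  using hom_of_quotient[OF max_filterD(1) quotient_emb_hom]
  by (simp add: quotient_val_def[abs_def])

lemma quotient_val_eq_one_iff:
  "\<lbrakk>U \<in> max_filters A; x \<in> carrier A\<rbrakk> \<Longrightarrow> quotient_val A U x = 1 \<longleftrightarrow> x \<in> U"
  by (simp add: quotient_val_def quotient_hom_eq_one_iff quotient_emb_hom)

lemma hom_mono:
  assumes "h \<in> mv_hom A std_mv" "x \<in> carrier A" "y \<in> carrier A" "x \<preceq> y"
  shows "h x \<le> h y"
  using assms(2-) mv_homD(3)[OF assms(1), of "\<sim> x" y] mv_homD(5,7)[OF assms(1)] 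
  by (simp add: mv_le_def)

section \<open>Semistates as infima of morphisms\<close>

text \<open>These are the properties of \<open>x \<mapsto> G x / U\<close> from which its representation as an infimum follows;
  monotonicity comes from superadditivity of \<open>G\<close>.\<close>

definition semistate :: "('a \<Rightarrow> real) \<Rightarrow> bool"
  where "semistate s \<longleftrightarrow> doubling_map A s \<and> s \<one> = 1
    \<and> (\<forall>x\<in>carrier A. \<forall>y\<in>carrier A. x \<preceq> y \<longrightarrow> s x \<le> s y)
    \<and> (\<forall>x\<in>carrier A. \<forall>y\<in>carrier A. s x + s y - 1 \<le> s (x \<odot> y))"

text \<open>The point is to force \<open>x / V < r\<close> while keeping \<open>s \<le> (_ / V)\<close>. The first condition follows
  from \<open>\<sim> c \<in> V\<close> for a word \<open>c\<close> in \<open>x\<close> separating \<open>s x\<close> from \<open>r\<close>, the second one from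
  \<open>{y. s y = 1} \<subseteq> V\<close>. These requirements are consistent since no multiple of \<open>c\<close> has value \<open>1\<close>.\<close>

lemma semistate_approx:
  assumes s: "semistate s" and x: "x \<in> carrier A" and r: "s x < r" "r \<le> 1"
  obtains V where "V \<in> max_filters A" "\<And>y. y \<in> carrier A \<Longrightarrow> s y \<le> quotient_val A V y"
    "quotient_val A V x < r"
proof -
  have dbl: "doubling_map A s" using s by (simp add: semistate_def)
  have mono: "\<And>x y. \<lbrakk>x \<in> carrier A; y \<in> carrier A; x \<preceq> y\<rbrakk> \<Longrightarrow> s x \<le> s y"
    and times: "\<And>x y. \<lbrakk>x \<in> carrier A; y \<in> carrier A\<rbrakk> \<Longrightarrow> s x + s y - 1 \<le> s (x \<odot> y)"
    and bounds: "\<And>x. x \<in> carrier A \<Longrightarrow> 0 \<le> s x \<and> s x \<le> 1"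
    using s by (auto simp: semistate_def doubling_map_def)
  obtain ds where ds: "word std_mv ds (s x) = 0" "word std_mv ds r = 1"
    using separating_word[of "s x" r] bounds[OF x] r by auto
  define c where "c = word A ds x"
  have c [simp]: "c \<in> carrier A" using x by (simp add: c_def)
  have sc: "s c = 0" 
    using ds doubling_map_word[OF mv_algebra_axioms dbl x] by (simp add: c_def)
  define F where "F = {y \<in> carrier A. s y = 1}"
  have F: "mv_filter A F"
    unfolding mv_filter_def
  proof (intro conjI ballI impI)
    show "\<one> \<in> F" using s by (simp add: F_def semistate_def)
  next
    fix y z assume "y \<in> F" "z \<in> carrier A" "y \<preceq> z"
    then show "z \<in> F" using mono[of y z] bounds[of z] by (simp add: F_def)
  next
    fix y z assume "y \<in> F" "z \<in> F"
    then show "y \<odot> z \<in> F" using times[of y z] bounds[of "y \<odot> z"] by (simp add: F_def)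
  qed (auto simp: F_def)
  \<comment> \<open>As \<open>s\<close> is only known to respect doubling, the multiples of \<open>c\<close> are bounded by iterated
    doubles.\<close>
  have "\<exists>d\<in>carrier A. multiple n c \<preceq> d \<and> c \<preceq> d \<and> s d = 0" for n
  proof (induction n)
    case 0
    show ?case using sc by (intro bexI[of _ c]) auto
  next
    case (Suc n)
    then obtain d where d: "d \<in> carrier A" "multiple n c \<preceq> d" "c \<preceq> d" "s d = 0" by blast
    then have "s (d \<oplus> d) = 0" using dbl by (simp add: doubling_map_def)
    moreover have "c \<preceq> d \<oplus> d" using d le_trans[of c d "d \<oplus> d"] le_plus by simp
    ultimately show ?case using d plus_mono[of c d "multiple n c" d]
      by (intro bexI[of _ "d \<oplus> d"]) auto
  qed
  then have "s (multiple n c) = 0" for n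
    using mono bounds by (metis c multiple_closed order_antisym)
  then have "multiple n c \<notin> F" for n by (simp add: F_def)
  then obtain V where V: "V \<in> max_filters A" "F \<subseteq> V" "\<sim> c \<in> V"
    using max_filter_adjoin[OF F c] by blast
  note v = quotient_val_hom[OF V(1)]
  have "s y \<le> quotient_val A V y" if y: "y \<in> carrier A" for y
  proof (rule doubling_map_le[OF mv_algebra_axioms dbl hom_doubling_map[OF v] _ y])
    show "quotient_val A V z = 1" if "z \<in> carrier A" "s z = 1" for z
      using that V quotient_val_eq_one_iff[of V z] by (auto simp: F_def)
  qed
  moreover have "quotient_val A V x < r"
  proof (rule ccontr)
    assume "\<not> quotient_val A V x < r"
    then have "1 \<le> word std_mv ds (quotient_val A V x)"
      using word_std_mono[of r "quotient_val A V x" ds] ds by simp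
    moreover have "quotient_val A V c = 0"
      using quotient_val_eq_one_iff[of V "\<sim> c"] V mv_homD(5)[OF v, of c] by simp
    ultimately show False
      using doubling_map_word[OF mv_algebra_axioms hom_doubling_map[OF v] x] by (simp add: c_def)
  qed
  ultimately show thesis using V(1) that by blast
qed

text \<open>If no morphism lies above \<open>s\<close>, then \<open>s\<close> is constantly \<open>1\<close>, in agreement with the value of the
  empty infimum.\<close>

lemma semistate_eq_Inf:
  assumes s: "semistate s" and x: "x \<in> carrier A"
  shows "s x = unit_Inf ((\<lambda>V. quotient_val A V x) `
    {V \<in> max_filters A. \<forall>y\<in>carrier A. s y \<le> quotient_val A V y})"
    (is "_ = unit_Inf (?f ` ?S)")
proof (cases "?S = {}")
  case True
  have "\<not> s x < 1"
  proof
    assume "s x < 1"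
    then show False
    proof (rule semistate_approx[OF s x _ order_refl])
      fix V assume "V \<in> max_filters A" "\<And>y. y \<in> carrier A \<Longrightarrow> s y \<le> quotient_val A V y"
      then show False using True by auto
    qed
  qed
  then have "s x = 1" using s x by (auto simp: semistate_def doubling_map_def)
  then show ?thesis unfolding True by (simp add: unit_Inf_def)
next
  case False
  have "Inf (?f ` ?S) = s x"
  proof (rule cInf_eq_non_empty)
    show "s x \<le> b" if "b \<in> ?f ` ?S" for b using that x by auto
    show "b \<le> s x" if b: "\<And>a. a \<in> ?f ` ?S \<Longrightarrow> b \<le> a" for b
    proof (rule ccontr)
      assume "\<not> b \<le> s x"
      moreover obtain W where "W \<in> ?S" using False by blast
      then have "b \<le> 1" using b[of "?f W"] mv_homD(2)[OF quotient_val_hom x, of W] by force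
      ultimately have "s x < b" "b \<le> 1" by auto
      then show False
      proof (rule semistate_approx[OF s x])
        fix V assume "V \<in> max_filters A" "\<And>y. y \<in> carrier A \<Longrightarrow> s y \<le> quotient_val A V y"
          "quotient_val A V x < b"
        then show False using b[of "?f V"] by auto
      qed
    qed
  qed (use False in simp)
  then show ?thesis using False by (simp only: unit_Inf_def image_is_empty if_False)
qed

lemma tense_operator_semistate:
  assumes U: "U \<in> max_filters A"
    and closed: "\<And>x. x \<in> carrier A \<Longrightarrow> K x \<in> carrier A"
    and one: "K \<one> = \<one>"
    and times: "\<And>x y. \<lbrakk>x \<in> carrier A; y \<in> carrier A\<rbrakk> \<Longrightarrow> K x \<odot> K y \<preceq> K (x \<odot> y)"
    and plus: "\<And>x y. \<lbrakk>x \<in> carrier A; y \<in> carrier A\<rbrakk> \<Longrightarrow> K x \<oplus> K y \<preceq> K (x \<oplus> y)"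
    and square: "\<And>x. x \<in> carrier A \<Longrightarrow> K x \<odot> K x = K (x \<odot> x)"
    and double: "\<And>x. x \<in> carrier A \<Longrightarrow> K x \<oplus> K x = K (x \<oplus> x)"
  shows "semistate (\<lambda>x. quotient_val A U (K x))"
proof -
  note v = quotient_val_hom[OF U]
  have mono: "K x \<preceq> K y" if [simp]: "x \<in> carrier A" "y \<in> carrier A" and "x \<preceq> y" for x y
  proof -
    have "y = x \<oplus> (y \<odot> \<sim> x)" using that by (rule le_eq_plus_diff)
    then have "K x \<oplus> K (y \<odot> \<sim> x) \<preceq> K y" using plus[of x "y \<odot> \<sim> x"] by simp
    then show ?thesis
      using closed le_plus[of "K x" "K (y \<odot> \<sim> x)"]
        le_trans[of "K x" "K x \<oplus> K (y \<odot> \<sim> x)" "K y"] by simp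
  qed
  have "quotient_val A U (K x) + quotient_val A U (K y) - 1 \<le> quotient_val A U (K (x \<odot> y))"
    if "x \<in> carrier A" "y \<in> carrier A" for x y
    using hom_mono[OF v _ _ times[OF that]] mv_homD(4)[OF v, of "K x" "K y"] that closed by simp
  then show ?thesis
    using mv_homD[OF v] closed one hom_mono[OF v _ _ mono]
    by (simp add: semistate_def doubling_map_def flip: square double)
qed

end

section \<open>The canonical frame of a tense MV-algebra\<close>

context tense_mv_algebra
begin

text \<open>The axioms \<open>G_H\<close> and \<open>H_G\<close> turn a bound for one operator into a bound for the other: applying
  \<open>G y / U \<le> y / V\<close> to \<open>y = \<sim> (H x)\<close> and negating gives \<open>H x / V \<le> \<sim> (G (\<sim> (H x))) / U \<le> x / U\<close>.\<close>

lemma tense_rel_converse: "(U, V) \<in> tense_rel A G \<longleftrightarrow> (V, U) \<in> tense_rel A H"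
proof -
  have galois: "quotient_val A V (L x) \<le> quotient_val A U x"
    if U: "U \<in> max_filters A" and V: "V \<in> max_filters A" and [simp]: "x \<in> carrier A"
      and closed: "\<And>x. x \<in> carrier A \<Longrightarrow> K x \<in> carrier A" "\<And>x. x \<in> carrier A \<Longrightarrow> L x \<in> carrier A"
      and KL: "\<sim> (K (\<sim> (L x))) \<preceq> x"
      and rel: "\<forall>y\<in>carrier A. quotient_val A U (K y) \<le> quotient_val A V y"
    for U V x K L
  proof -
    note u = quotient_val_hom[OF U] and v = quotient_val_hom[OF V]
    have "1 - quotient_val A U (K (\<sim> (L x))) \<le> quotient_val A U x"
      using hom_mono[OF u _ _ KL] mv_homD(5)[OF u] closed by simp
    moreover have "quotient_val A U (K (\<sim> (L x))) \<le> 1 - quotient_val A V (L x)"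
      using bspec[OF rel, of "\<sim> (L x)"] mv_homD(5)[OF v, of "L x"] closed by simp
    ultimately show ?thesis by simp
  qed
  show ?thesis
  proof
    assume rel: "(U, V) \<in> tense_rel A G"
    have "quotient_val A V (H x) \<le> quotient_val A U x" if "x \<in> carrier A" for x
      by (rule galois[where K = G]) (use rel that G_H in \<open>simp_all add: tense_rel_def\<close>)
    then show "(V, U) \<in> tense_rel A H"
      using rel by (simp add: tense_rel_def)
  next
    assume rel: "(V, U) \<in> tense_rel A H"
    have "quotient_val A U (G x) \<le> quotient_val A V x" if "x \<in> carrier A" for x
      by (rule galois[where K = H]) (use rel that H_G in \<open>simp_all add: tense_rel_def\<close>)
    then show "(U, V) \<in> tense_rel A G"
      using rel by (simp add: tense_rel_def)
  qed
qed

lemma G_eq_Inf: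
  assumes U: "U \<in> max_filters A" and x: "x \<in> carrier A"
  shows "quotient_val A U (G x)
    = unit_Inf ((\<lambda>V. quotient_val A V x) ` {V \<in> max_filters A. (U, V) \<in> tense_rel A G})"
proof -
  have "semistate (\<lambda>x. quotient_val A U (G x))"
    by (intro tense_operator_semistate U G_closed G_one G_times G_plus G_square G_double)
  then show ?thesis
    using semistate_eq_Inf[of "\<lambda>x. quotient_val A U (G x)" x] U x
    by (simp add: tense_rel_def cong: conj_cong)
qed

lemma H_eq_Inf:
  assumes U: "U \<in> max_filters A" and x: "x \<in> carrier A"
  shows "quotient_val A U (H x)
    = unit_Inf ((\<lambda>V. quotient_val A V x) ` {V \<in> max_filters A. (V, U) \<in> tense_rel A G})"
proof -
  have "semistate (\<lambda>x. quotient_val A U (H x))"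
    by (intro tense_operator_semistate U H_closed H_one H_times H_plus H_square H_double)
  then show ?thesis
    using semistate_eq_Inf[of "\<lambda>x. quotient_val A U (H x)" x] U x
    unfolding tense_rel_converse by (simp add: tense_rel_def cong: conj_cong)
qed

end

lemma power_mv_simps:
  "carrier (power_mv T) = T \<rightarrow>\<^sub>E {0..1}"
  "f \<oplus>\<^bsub>power_mv T\<^esub> g = (\<lambda>i\<in>T. min 1 (f i + g i))"
  "\<sim>\<^bsub>power_mv T\<^esub> f = (\<lambda>i\<in>T. 1 - f i)"
  "\<zero>\<^bsub>power_mv T\<^esub> = (\<lambda>i\<in>T. 0)"
  "\<one>\<^bsub>power_mv T\<^esub> = (\<lambda>i\<in>T. 1)"
  "f \<odot>\<^bsub>power_mv T\<^esub> g = (\<lambda>i\<in>T. max 0 (f i + g i - 1))"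
  unfolding mv_one_def[of "power_mv T"] mv_times_def[of "power_mv T"]
  by (auto simp: power_mv_def min_def max_def fun_eq_iff)

lemma (in mv_algebra) quotient_vals_hom:
  "(\<lambda>x. \<lambda>U\<in>max_filters A. quotient_val A U x) \<in> mv_hom A (power_mv (max_filters A))"
  using mv_homD[OF quotient_val_hom]
  unfolding mv_hom_def power_mv_simps by (auto intro!: restrict_ext)

text \<open>Elements with equal values satisfy \<open>(\<sim> x \<oplus> y) / U = 1\<close> for all \<open>U\<close>, so \<open>\<sim> x \<oplus> y\<close> lies in
  every maximal filter and is \<open>1\<close> by semisimplicity.\<close>

lemma (in mv_algebra) quotient_vals_inj:
  assumes "semisimple_mv A"
  shows "inj_on (\<lambda>x. \<lambda>U\<in>max_filters A. quotient_val A U x) (carrier A)"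
proof (rule inj_onI)
  fix x y
  assume [simp]: "x \<in> carrier A" "y \<in> carrier A"
    and "(\<lambda>U\<in>max_filters A. quotient_val A U x) = (\<lambda>U\<in>max_filters A. quotient_val A U y)"
  then have eq: "quotient_val A U x = quotient_val A U y" if "U \<in> max_filters A" for U
    using that by (metis restrict_apply')
  have le: "x' \<preceq> y'"
    if [simp]: "x' \<in> carrier A" "y' \<in> carrier A"
      and eq: "\<And>U. U \<in> max_filters A \<Longrightarrow> quotient_val A U x' = quotient_val A U y'" for x' y'
  proof -
    have "\<sim> x' \<oplus> y' \<in> U" if U: "U \<in> max_filters A" for U
      using mv_homD(3,5)[OF quotient_val_hom[OF U]] eq[OF U] 
        quotient_val_eq_one_iff[OF U, of "\<sim> x' \<oplus> y'"] by simp
    then have "\<sim> x' \<oplus> y' \<in> carrier A \<inter> \<Inter> (max_filters A)" by simp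
    then show ?thesis using assms unfolding semisimple_mv_def mv_le_def by blast
  qed
  show "x = y" using le[of x y] le[of y x] eq by (intro le_antisym) auto
qed

theorem theorem5:
  fixes A :: "('a, 'm) mv_struct_scheme"
    and G H :: "'a \<Rightarrow> 'a"
  assumes "tense_mv_algebra A G H"
    and "semisimple_mv A"
  shows "\<exists>e \<in> mv_hom A (power_mv (max_filters A)).
    inj_on e (carrier A)
    \<and> (\<forall>x \<in> carrier A. e (G x) = frame_G (max_filters A) (tense_rel A G) (e x))
    \<and> (\<forall>x \<in> carrier A. e (H x) = frame_H (max_filters A) (tense_rel A G) (e x))"
proof -
  interpret tense_mv_algebra A G H by fact
  let ?T = "max_filters A"
  let ?e = "\<lambda>x. \<lambda>U\<in>?T. quotient_val A U x"
  \<comment> \<open>The infima of the frame operators range over \<open>?T\<close> only, where the restriction is invisible.\<close>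
  have "(\<lambda>V\<in>?T. quotient_val A V x) ` {V \<in> ?T. P V} = (\<lambda>V. quotient_val A V x) ` {V \<in> ?T. P V}"
    for x P by (rule image_cong) auto
  then have "?e (G x) = frame_G ?T (tense_rel A G) (?e x)"
    and "?e (H x) = frame_H ?T (tense_rel A G) (?e x)" if "x \<in> carrier A" for x
    unfolding frame_G_def frame_H_def using that
    by (auto simp: G_eq_Inf H_eq_Inf intro!: restrict_ext)
  then show ?thesis
    using quotient_vals_hom quotient_vals_inj[OF assms(2)] by (intro bexI[of _ ?e]) auto
qed

end
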